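(* Let $\Phi=(G,\varphi)$ be a finite complex unit gain graph of order $n$ (without loops and multiple edges). Then $r(\Phi)=r(G)-2\theta(G)$ if and only if all of the following hold: (1) the cycles (if any) of $G$ are pairwise vertex-disjoint; (2) each cycle $C_p^{\varphi}$ of $\Phi$ is of Type A and has order $p\equiv 2 \pmod 4$; (3) a series of $\delta$-transformations can transform $G$ into a crucial subgraph $G_0$ that is the disjoint union of $\theta(G)$ cycles together with some isolated vertices.
   Context: A complex unit gain graph $\Phi=(G,\varphi)$ consists of a finite simple graph $G$ (the underlying graph) with vertex set $\{v_1,\dots,v_n\}$ and a gain function $\varphi$ assigning to each oriented edge $e_{ij}$ (from $v_i$ to $v_j$, where $v_iv_j\in E(G)$) a complex number of modulus $1$, with $\varphi(e_{ji})=\overline{\varphi(e_{ij})}$. The adjacency matrix $A(\Phi)$ is the Hermitian matrix with $(i,j)$ entry $\varphi(e_{ij})$ if $v_iv_j\in E(G)$ and $0$ otherwise; $r(\Phi)$ is its rank, and $r(G)$ is the rank of the $0$-$1$ adjacency matrix of $G$. $\theta(G)=|E(G)|-|V(G)|+\omega(G)$, where $\omega(G)$ is the number of connected components. Subgraphs of $\Phi$ carry the gains of $\Phi$; a cycle $C_p^\varphi$ of $\Phi$ is a cycle of $G$ with its gains. For a gain cycle $C_p^{\varphi}$ with vertices $v_1,\dots,v_p$ in cyclic order, $\varphi(C_p)=\varphi(e_{12})\varphi(e_{23})\cdots\varphi(e_{p1})$; for $p$ even it is of Type A if $\varphi(C_p)=(-1)^{p/2}$. A $\delta$-transformation of a graph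 with a pendant vertex (vertex of degree $1$) deletes a pendant vertex together with its unique neighbour. A crucial subgraph of $G$ is a graph without pendant vertices obtained from $G$ by a series of $\delta$-transformations. *)

theory Defs
  imports "Jordan_Normal_Form.DL_Rank"
begin

text \<open>Simple graph on vertex set {0..<n} (vertices v_1..v_n are 0..n-1), given by a
symmetric irreflexive adjacency relation E; a gain function phi on oriented edges.\<close>

definition simple_graph :: "nat \<Rightarrow> (nat \<Rightarrow> nat \<Rightarrow> bool) \<Rightarrow> bool" where
  "simple_graph n E \<longleftrightarrow> (\<forall>u v. E u v \<longrightarrow> u < n \<and> v < n) \<and> (\<forall>u. \<not> E u u)
     \<and> (\<forall>u v. E u v \<longrightarrow> E v u)"

definition unit_gain :: "(nat \<Rightarrow> nat \<Rightarrow> bool) \<Rightarrow> (nat \<Rightarrow> nat \<Rightarrow> complex) \<Rightarrow> bool" where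
  "unit_gain E phi \<longleftrightarrow> (\<forall>u v. E u v \<longrightarrow> cmod (phi u v) = 1 \<and> phi v u = cnj (phi u v))"

definition gain_adj :: "nat \<Rightarrow> (nat \<Rightarrow> nat \<Rightarrow> bool) \<Rightarrow> (nat \<Rightarrow> nat \<Rightarrow> complex) \<Rightarrow> complex mat" where
  "gain_adj n E phi = mat n n (\<lambda>(i,j). if E i j then phi i j else 0)"

definition adj01 :: "nat \<Rightarrow> (nat \<Rightarrow> nat \<Rightarrow> bool) \<Rightarrow> real mat" where
  "adj01 n E = mat n n (\<lambda>(i,j). if E i j then 1 else 0)"

definition gain_rank :: "nat \<Rightarrow> (nat \<Rightarrow> nat \<Rightarrow> bool) \<Rightarrow> (nat \<Rightarrow> nat \<Rightarrow> complex) \<Rightarrow> nat" where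
  "gain_rank n E phi = vec_space.rank n (gain_adj n E phi)"

definition graph_rank :: "nat \<Rightarrow> (nat \<Rightarrow> nat \<Rightarrow> bool) \<Rightarrow> nat" where
  "graph_rank n E = vec_space.rank n (adj01 n E)"

definition edges :: "nat \<Rightarrow> (nat \<Rightarrow> nat \<Rightarrow> bool) \<Rightarrow> nat set set" where
  "edges n E = {{u, v} | u v. u < n \<and> v < n \<and> E u v}"

definition num_components :: "nat \<Rightarrow> (nat \<Rightarrow> nat \<Rightarrow> bool) \<Rightarrow> nat" where
  "num_components n E =
     card ((\<lambda>v. {w. w < n \<and> (\<lambda>x y. E x y \<and> x < n \<and> y < n)\<^sup>*\<^sup>* v w}) ` {0..<n})"

definition theta :: "nat \<Rightarrow> (nat \<Rightarrow> nat \<Rightarrow> bool) \<Rightarrow> int" where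
  "theta n E = int (card (edges n E)) - int n + int (num_components n E)"

definition is_cycle :: "nat \<Rightarrow> (nat \<Rightarrow> nat \<Rightarrow> bool) \<Rightarrow> nat list \<Rightarrow> bool" where
  "is_cycle n E c \<longleftrightarrow> length c \<ge> 3 \<and> distinct c \<and> set c \<subseteq> {0..<n}
     \<and> (\<forall>i < length c. E (c ! i) (c ! ((i + 1) mod length c)))"

definition cycle_edges :: "nat list \<Rightarrow> nat set set" where
  "cycle_edges c = {{c ! i, c ! ((i + 1) mod length c)} | i. i < length c}"

definition cycle_gain :: "(nat \<Rightarrow> nat \<Rightarrow> complex) \<Rightarrow> nat list \<Rightarrow> complex" where
  "cycle_gain phi c = (\<Prod>i<length c. phi (c ! i) (c ! ((i + 1) mod length c)))"

definition type_A :: "(nat \<Rightarrow> nat \<Rightarrow> complex) \<Rightarrow> nat list \<Rightarrow> bool" where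
  "type_A phi c \<longleftrightarrow> even (length c) \<and> cycle_gain phi c = (-1) ^ (length c div 2)"

definition deg_in :: "(nat \<Rightarrow> nat \<Rightarrow> bool) \<Rightarrow> nat set \<Rightarrow> nat \<Rightarrow> nat" where
  "deg_in E W v = card {u \<in> W. E v u}"

definition delta_step :: "(nat \<Rightarrow> nat \<Rightarrow> bool) \<Rightarrow> nat set \<Rightarrow> nat set \<Rightarrow> bool" where
  "delta_step E W W' \<longleftrightarrow> (\<exists>u v. u \<in> W \<and> v \<in> W \<and> deg_in E W u = 1 \<and> E u v
      \<and> W' = W - {u, v})"

definition no_pendant :: "(nat \<Rightarrow> nat \<Rightarrow> bool) \<Rightarrow> nat set \<Rightarrow> bool" where
  "no_pendant E W \<longleftrightarrow> (\<forall>v \<in> W. deg_in E W v \<noteq> 1)"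

definition union_cycles_isolated ::
  "nat \<Rightarrow> (nat \<Rightarrow> nat \<Rightarrow> bool) \<Rightarrow> nat set \<Rightarrow> nat \<Rightarrow> bool" where
  "union_cycles_isolated n E W k \<longleftrightarrow> (\<exists>cs. length cs = k
      \<and> (\<forall>c \<in> set cs. is_cycle n E c \<and> set c \<subseteq> W)
      \<and> (\<forall>i < k. \<forall>j < k. i \<noteq> j \<longrightarrow> set (cs ! i) \<inter> set (cs ! j) = {})
      \<and> {{u, v} | u v. u \<in> W \<and> v \<in> W \<and> E u v} = (\<Union>c \<in> set cs. cycle_edges c))"

end

theory Submission
  imports Defs "HOL-Library.Function_Algebras" "Jordan_Normal_Form.Matrix_Kernel"
begin

text \<open>
  For a vertex set \<open>W\<close> let \<open>r\<^sub>\<phi> W\<close>, \<open>r\<^sub>1 W\<close> and \<open>\<theta> W\<close> be the two ranks and the cyclomatic number of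
  the induced subgraph. Deleting a vertex lowers a rank by at most 2, a \<open>\<delta>\<close>-transformation lowers
  both ranks by exactly 2, and deleting a cycle vertex lowers \<open>\<theta>\<close> by at least 1; hence
  \<open>r\<^sub>\<phi> W \<ge> r\<^sub>1 W - 2 * \<theta> W\<close>. If equality holds (\<open>W\<close> is tight), all these estimates are sharp: deleting
  any cycle vertex preserves tightness and \<open>r\<^sub>\<phi>\<close>, and lowers \<open>r\<^sub>1\<close> by 2 and \<open>\<theta>\<close> by 1. Two cycles that
  meet have a common vertex whose deletion lowers \<open>\<theta>\<close> by 2, so the cycles are disjoint; the neighbour of a
  pendant vertex lies on no cycle, so \<open>\<delta>\<close>-transformations preserve tightness. Without pendant vertices
  there is a cycle attached to the rest in at most one vertex. Peeling it in two ways shows that it is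
  a component, since otherwise a tight graph with a dangling end would remain. Whether a cycle vertex
  changes a rank by 0 or by 2 is read off kernel vectors, which on a component cycle can be computed
  explicitly; this yields Type A and length 2 modulo 4. The same computation gives the converse.
\<close>

section \<open>Ranks of Hermitian matrices via kernels\<close>

text \<open>The delicate point is odd length. A cycle attached at \<open>e = c ! 0\<close> is peeled
  after deleting either \<open>e\<close>, which consumes the whole cycle up to perhaps one isolated
  vertex, or the neighbour \<open>c ! 1\<close>, which leaves \<open>e\<close> hanging on the rest.
  The second peeling removes pairs and stops exactly at \<open>e\<close> only for even length, and
  the explicit kernel vectors also advance two positions at a time. So evenness has to come first,
  when the cycle is not yet known to be a component. A real and a complex kernel vector cannot be
  compared directly; \<open>tight_even_cycle\<close> therefore turns the real one into a rank
  statement, moves it to the gain matrix by the lower bound for \<open>rg\<close>, and converts it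
  back into a complex vector. A dangling end is contradictory because tightness of both
  \<open>H\<close> and \<open>H - {e}\<close> reproduces itself one vertex further in. Deleting one
  vertex can also change a rank by 1; only the changes 0 and 2 have kernel witnesses, and at cycle
  vertices tightness forces precisely these.\<close>

definition fscale :: "'a::field \<Rightarrow> (nat \<Rightarrow> 'a) \<Rightarrow> nat \<Rightarrow> 'a" where
  "fscale c f = (\<lambda>i. c * f i)"

interpretation fv: Vector_Spaces.vector_space fscale
  by unfold_locales (auto simp: fscale_def plus_fun_def algebra_simps)

lemma sum_fun_at: "(\<Sum>b\<in>B. f b) i = (\<Sum>b\<in>B. f b (i::nat))"
  for f :: "'b \<Rightarrow> nat \<Rightarrow> 'a::comm_monoid_add"
  by (induction B rule: infinite_finite_induct) (auto simp: plus_fun_def zero_fun_def)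

lemma span_unit_functions:
  fixes z :: "nat \<Rightarrow> 'a::field"
  assumes "finite W" and "\<And>v. v \<notin> W \<Longrightarrow> z v = 0"
  shows "z \<in> fv.span ((\<lambda>i j. if j = i then 1 else 0) ` W)"
proof -
  have "z = (\<Sum>i\<in>W. fscale (z i) (\<lambda>j. if j = i then 1 else 0))"
  proof
    fix j
    show "z j = (\<Sum>i\<in>W. fscale (z i) (\<lambda>j. if j = i then 1 else 0)) j"
      using assms by (auto simp: sum_fun_at fscale_def if_distrib cong: if_cong)
  qed
  moreover have "(\<Sum>i\<in>W. fscale (z i) (\<lambda>j. if j = i then 1 else 0))
      \<in> fv.span ((\<lambda>i j. if j = i then 1 else 0) ` W)"
    by (intro fv.span_sum fv.span_scale fv.span_base) auto
  ultimately show ?thesis by simp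
qed

text \<open>A basis of the kernel of \<open>f\<close> in \<open>K\<close>, together with any
  \<open>x \<in> K\<close> where \<open>f\<close> does not vanish, is a basis of \<open>K\<close>:
  subtracting the multiple \<open>f z / f x\<close> of \<open>x\<close> moves \<open>z\<close> into
  that kernel. The whole function space is infinite-dimensional, so it is the finite set
  \<open>F\<close> that makes the basis finite.\<close>

lemma dim_functional:
  fixes K :: "(nat \<Rightarrow> 'a::field) set" and f :: "(nat \<Rightarrow> 'a) \<Rightarrow> 'a"
  assumes K: "fv.subspace K" and sp: "K \<subseteq> fv.span F" "finite F"
    and add: "\<And>y z. f (y + z) = f y + f z" and scale: "\<And>c z. f (fscale c z) = c * f z"
  shows "fv.dim K = fv.dim {z \<in> K. f z = 0} + (if \<exists>z\<in>K. f z \<noteq> 0 then 1 else 0)"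
proof (cases "\<exists>z\<in>K. f z \<noteq> 0")
  case False
  then have "{z \<in> K. f z = 0} = K" by auto
  with False show ?thesis by auto
next
  case True
  then obtain x where x: "x \<in> K" "f x \<noteq> 0" by auto
  let ?K0 = "{z \<in> K. f z = 0}"
  have f0: "f 0 = 0" using scale[of 0 0] by (simp add: fv.scale_zero_left)
  have K0: "fv.subspace ?K0"
    using K f0 by (auto simp: fv.subspace_def add scale)
  obtain B where B: "B \<subseteq> ?K0" "fv.independent B" "?K0 \<subseteq> fv.span B" "card B = fv.dim ?K0"
    using fv.basis_exists[of ?K0] by blast
  have "finite B"
    using fv.independent_span_bound[OF sp(2) B(2)] B(1) sp(1) by auto
  have spB: "fv.span B \<subseteq> ?K0" using B(1) K0 by (rule fv.span_minimal)
  have xB: "x \<notin> fv.span B" using spB x by auto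
  have "fv.dim K = card (insert x B)"
  proof (rule fv.dim_unique)
    show "insert x B \<subseteq> K" using B(1) x by auto
    show "K \<subseteq> fv.span (insert x B)"
    proof
      fix z assume z: "z \<in> K"
      let ?c = "f z / f x"
      have "z - fscale ?c x \<in> K" using K z x by (simp add: fv.subspace_diff fv.subspace_scale)
      moreover have "f (z - fscale ?c x) = 0"
        using add[of "z - fscale ?c x" "fscale ?c x"] x by (simp add: scale)
      ultimately have "z - fscale ?c x \<in> fv.span B" using B(3) by auto
      then show "z \<in> fv.span (insert x B)" unfolding fv.span_insert by blast
    qed
    show "fv.independent (insert x B)" using xB B(2) by (rule fv.independent_insertI)
  qed simp
  moreover have "x \<notin> B" using xB fv.span_base by auto
  ultimately show ?thesis using \<open>finite B\<close> B(4) True by simp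
qed

text \<open>Kernel of the principal submatrix on \<open>W\<close>, with vectors extended by zero.
  Kernels for different \<open>W\<close> then lie in one space and can be intersected without
  reindexing.\<close>

definition ker :: "(nat \<Rightarrow> nat \<Rightarrow> 'a::field) \<Rightarrow> nat set \<Rightarrow> (nat \<Rightarrow> 'a) set" where
  "ker a W = {z. (\<forall>v. v \<notin> W \<longrightarrow> z v = 0) \<and> (\<forall>u\<in>W. (\<Sum>v\<in>W. a u v * z v) = 0)}"

text \<open>Rank-nullity taken as the definition, with values in \<open>int\<close> so that
  differences of ranks do not truncate.\<close>

definition rk :: "(nat \<Rightarrow> nat \<Rightarrow> 'a::field) \<Rightarrow> nat set \<Rightarrow> int" where
  "rk a W = int (card W) - int (fv.dim (ker a W))"

lemma subspace_ker: "fv.subspace (ker a W)"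
proof -
  have "(\<Sum>v\<in>W. a u v * (c * z v)) = c * (\<Sum>v\<in>W. a u v * z v)" for u c and z :: "nat \<Rightarrow> 'a"
    by (simp add: sum_distrib_left mult.left_commute)
  then show ?thesis
    by (simp add: fv.subspace_def ker_def plus_fun_def zero_fun_def fscale_def
        distrib_left sum.distrib)
qed

lemma ker_outside: "z \<in> ker a S \<Longrightarrow> v \<notin> S \<Longrightarrow> z v = 0"
  by (simp add: ker_def)

lemma ker_span: "finite W \<Longrightarrow> ker a W \<subseteq> fv.span ((\<lambda>i j. if j = i then 1 else 0) ` W)"
  by (intro subsetI span_unit_functions) (simp_all add: ker_def)

lemma rk_empty: "rk a {} = 0"
proof -
  have "ker a {} = {0}" by (auto simp: ker_def)
  moreover have "fv.dim {0 :: nat \<Rightarrow> 'a} = card ({} :: (nat \<Rightarrow> 'a) set)"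
    by (rule fv.dim_unique) (auto simp: fv.independent_empty)
  ultimately show ?thesis by (simp add: rk_def)
qed

text \<open>\<open>conj\<close> stays abstract so that the same lemmas serve the gain matrix
  (complex conjugation) and the 0-1 matrix (the identity on the reals).\<close>

locale hermitian_entries =
  fixes a :: "nat \<Rightarrow> nat \<Rightarrow> 'a::field" and conj :: "'a \<Rightarrow> 'a"
  assumes herm: "a v u = conj (a u v)"
    and conj_add: "conj (x + y) = conj x + conj y"
    and conj_mult: "conj (x * y) = conj x * conj y"
    and conj_conj: "conj (conj x) = x"
begin

\<comment> \<open>Not a simp rule: for the identity in place of \<open>conj\<close> it would read \<open>0 = 0\<close> and loop.\<close>
lemma conj_0: "conj 0 = 0"
  by (metis conj_add add_cancel_right_right add.right_neutral)

lemma conj_sum: "conj (sum f S) = (\<Sum>i\<in>S. conj (f i))"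
  by (induction S rule: infinite_finite_induct) (auto simp: conj_add conj_0)

text \<open>Both kernels contain the same vectors with vanishing \<open>x\<close>-coordinate and vanishing
  \<open>x\<close>-row; Hermitian symmetry excludes that both of them are strictly larger.\<close>

lemma rk_remove:
  assumes "finite W" "x \<in> W" "a x x = 0"
  defines "\<alpha> \<equiv> \<exists>z\<in>ker a W. z x \<noteq> 0"
    and "\<beta> \<equiv> \<exists>z\<in>ker a (W - {x}). (\<Sum>v\<in>W - {x}. a x v * z v) \<noteq> 0"
  shows "rk a W = rk a (W - {x}) + 1 - of_bool \<alpha> + of_bool \<beta>" and "\<not> (\<alpha> \<and> \<beta>)"
proof -
  let ?S = "W - {x}"
  let ?f = "\<lambda>z :: nat \<Rightarrow> 'a. \<Sum>v\<in>?S. a x v * z v"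
  have fin: "finite ?S" using assms by simp
  have split: "(\<Sum>v\<in>W. a u v * z v) = a u x * z x + (\<Sum>v\<in>?S. a u v * z v)" for u z
    using assms(1,2) by (rule sum.remove)
  have "{z \<in> ker a W. z x = 0} = {z \<in> ker a ?S. ?f z = 0}"
    using assms(2,3) by (auto simp: ker_def split)
  moreover have "fv.dim (ker a W) = fv.dim {z \<in> ker a W. z x = 0} + of_bool \<alpha>"
    using dim_functional[where f = "\<lambda>z. z x", OF subspace_ker ker_span[OF assms(1)], of a] assms(1)
    unfolding \<alpha>_def by (simp add: fscale_def plus_fun_def)
  moreover have "fv.dim (ker a ?S) = fv.dim {z \<in> ker a ?S. ?f z = 0} + of_bool \<beta>"
  proof -
    have "?f (y + z) = ?f y + ?f z" for y z
      by (simp add: plus_fun_def distrib_left sum.distrib)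
    moreover have "?f (fscale c z) = c * ?f z" for c z
      by (simp add: fscale_def sum_distrib_left mult.left_commute)
    ultimately show ?thesis
      using dim_functional[where f = ?f, OF subspace_ker ker_span[OF fin], of a] fin
      unfolding \<beta>_def by simp
  qed
  moreover have "card W = card ?S + 1" using assms by (metis card_Suc_Diff1 Suc_eq_plus1)
  ultimately show "rk a W = rk a (W - {x}) + 1 - of_bool \<alpha> + of_bool \<beta>"
    by (simp add: rk_def)
  show "\<not> (\<alpha> \<and> \<beta>)"
  proof
    assume "\<alpha> \<and> \<beta>"
    then obtain y z where z: "z \<in> ker a W" "z x \<noteq> 0" and y: "y \<in> ker a ?S" "?f y \<noteq> 0"
      unfolding \<alpha>_def \<beta>_def by auto
    have zW: "(\<Sum>v\<in>W. a u v * z v) = 0" if "u \<in> W" for u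
      using z that by (auto simp: ker_def)
    have yS: "(\<Sum>v\<in>?S. a u v * y v) = 0" if "u \<in> ?S" for u
      using y that by (auto simp: ker_def)
    \<comment> \<open>The sesquilinear form of \<open>y\<close> and \<open>z\<close> is evaluated
      twice: the rows of \<open>z\<close> vanish, while after transposition \<open>y\<close> kills
      every column except \<open>x\<close>.\<close>
    have "(\<Sum>u\<in>?S. conj (y u) * (\<Sum>v\<in>W. a u v * z v)) = 0"
      using zW by (intro sum.neutral) auto
    also have "(\<Sum>u\<in>?S. conj (y u) * (\<Sum>v\<in>W. a u v * z v))
        = (\<Sum>v\<in>W. z v * conj (\<Sum>u\<in>?S. a v u * y u))"
      unfolding conj_sum conj_mult sum_distrib_left herm[symmetric]
      by (subst sum.swap) (simp only: mult_ac)
    also have "\<dots> = z x * conj (?f y)"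
      using assms(1,2) yS by (simp add: sum.remove[of W x] conj_0)
    finally have "conj (?f y) = 0" using z by simp
    then have "?f y = 0" using conj_conj conj_0 by metis
    with y show False by simp
  qed
qed

end

section \<open>Comparison with the matrix rank\<close>

lemma (in vec_space) image_eq_span_cols:
  fixes A :: "'a mat"
  assumes A: "A \<in> carrier_mat n n"
  shows "(\<lambda>v. A *\<^sub>v v) ` carrier_vec n = span (set (cols A))"
proof -
  have sub: "set (cols A) \<subseteq> carrier_vec n" using A cols_dim by blast
  have len: "length (cols A) = n" using A by simp
  have mc: "mat_of_cols n (cols A) = A" using A by (metis carrier_matD(1) mat_of_cols_cols)
  have lc: "lincomb_list c (cols A) = A *\<^sub>v vec n c" for c
    using lincomb_list_as_mat_mult[of "cols A" c] sub unfolding len mc by (auto simp: subset_iff)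
  have "(\<lambda>v. A *\<^sub>v v) ` carrier_vec n = span_list (cols A)"
  proof (intro equalityI subsetI)
    fix w assume "w \<in> (\<lambda>v. A *\<^sub>v v) ` carrier_vec n"
    then obtain v where v: "v \<in> carrier_vec n" "w = A *\<^sub>v v" by auto
    then have "w = lincomb_list (\<lambda>i. v $ i) (cols A)" unfolding lc by (metis carrier_vecD vec_eq_iff index_vec dim_vec)
    then show "w \<in> span_list (cols A)" unfolding span_list_def by auto
  next
    fix w assume "w \<in> span_list (cols A)"
    then show "w \<in> (\<lambda>v. A *\<^sub>v v) ` carrier_vec n" unfolding span_list_def lc by auto
  qed
  then show ?thesis using span_list_as_span[OF sub] by simp
qed

text \<open>Rank-nullity for multiplication by \<open>A\<close>: \<open>image_eq_span_cols\<close>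
  identifies the range with the column span, whose dimension is the matrix rank.\<close>

lemma rank_plus_kernel_dim:
  fixes A :: "'a::field mat"
  assumes A: "A \<in> carrier_mat n n"
  shows "vec_space.rank n A + kernel_dim A = n"
proof -
  interpret kernel n n A by unfold_locales (rule A)
  interpret L: linear_map class_ring NC.V NC.V "\<lambda>v. A *\<^sub>v v"
  proof (unfold_locales)
    show "(*\<^sub>v) A \<in> LinearCombinations.module_hom class_ring NC.V NC.V"
      using A by (auto simp: LinearCombinations.module_hom_def module_vec_simps class_ring_simps
         mult_add_distrib_mat_vec[OF A] mult_mat_vec[OF A])
  qed
  have im: "L.im = NC.span (set (cols A))"
    unfolding L.im_def using NC.image_eq_span_cols[OF A] by (simp add: module_vec_simps)
  have ker: "L.ker = mat_kernel A"
    unfolding L.ker_def mat_kernel_def using A by (auto simp: module_vec_simps)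
  have "vectorspace.dim class_ring (NC.vs L.im) + vectorspace.dim class_ring (NC.vs L.ker) = n"
    using L.rank_nullity[OF NC.fin_dim] NC.dim_is_n by simp
  then show ?thesis unfolding im ker NC.rank_def kernel_dim using A by simp
qed

text \<open>Extension by zero, \<open>h\<close>, is injective and maps the matrix kernel onto
  \<open>ker a {0..<n}\<close>, hence a basis to a basis.\<close>

lemma rank_eq_rk:
  fixes a :: "nat \<Rightarrow> nat \<Rightarrow> 'a::field"
  shows "int (vec_space.rank n (mat n n (\<lambda>(i, j). a i j))) = rk a {0..<n}"
proof -
  define A where "A = mat n n (\<lambda>(i, j). a i j)"
  have A: "A \<in> carrier_mat n n" by (simp add: A_def)
  interpret kernel n n A by unfold_locales (rule A)
  define h :: "'a vec \<Rightarrow> nat \<Rightarrow> 'a" where "h v = (\<lambda>i. if i < n then v $ i else 0)" for v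
  obtain B where B: "finite B" "basis B" using kernel_basis_exists[OF A] by auto
  have Bk: "B \<subseteq> mat_kernel A" and li: "lin_indpt B" and gen: "span B = mat_kernel A"
    using B(2) by (auto simp: Ker.basis_def)
  have mult: "(A *\<^sub>v v) $ i = (\<Sum>j\<in>{0..<n}. a i j * h v j)" if "i < n" "v \<in> carrier_vec n" for i v
    using that A by (auto simp: A_def scalar_prod_def h_def intro!: sum.cong)
  have hk: "h v \<in> ker a {0..<n}" if "v \<in> mat_kernel A" for v
  proof -
    have v: "v \<in> carrier_vec n" "A *\<^sub>v v = 0\<^sub>v n" using mat_kernelD[OF A that] by auto
    have "(\<Sum>j\<in>{0..<n}. a i j * h v j) = 0" if "i < n" for i
      using mult[OF that v(1)] v(2) that by simp
    then show ?thesis by (auto simp: ker_def h_def)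
  qed
  have inj: "inj_on h (carrier_vec n)"
    by (rule inj_onI, rule eq_vecI) (auto simp: h_def fun_eq_iff split: if_splits)
  then have injB: "inj_on h B" using Bk mat_kernel_carrier[OF A] by (meson inj_on_subset)
  have lin: "h (lincomb c B) = (\<Sum>b\<in>B. fscale (c b) (h b))" for c
    using lincomb_index[OF _ Bk] by (auto simp: fun_eq_iff sum_fun_at fscale_def h_def)
  have "fv.dim (ker a {0..<n}) = card (h ` B)"
  proof (rule fv.dim_unique)
    show "h ` B \<subseteq> ker a {0..<n}" using hk Bk by auto
    show "ker a {0..<n} \<subseteq> fv.span (h ` B)"
    proof
      fix z assume z: "z \<in> ker a {0..<n}"
      have hz: "h (vec n z) = z" using z by (auto simp: h_def ker_def)
      have "vec n z \<in> mat_kernel A"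
      proof (rule mat_kernelI[OF A])
        show "A *\<^sub>v vec n z = 0\<^sub>v n"
          using A mult[of _ "vec n z"] z by (intro eq_vecI) (auto simp: hz ker_def)
      qed simp
      then obtain c where "vec n z = lincomb c B"
        using gen Ker.finite_span[OF B(1)] Bk by blast
      then have "z = (\<Sum>b\<in>B. fscale (c b) (h b))" using lin hz by metis
      moreover have "(\<Sum>b\<in>B. fscale (c b) (h b)) \<in> fv.span (h ` B)"
        by (intro fv.span_sum fv.span_scale fv.span_base imageI)
      ultimately show "z \<in> fv.span (h ` B)" by simp
    qed
    show "fv.independent (h ` B)"
    proof (rule fv.independent_if_scalars_zero)
      fix f x assume f: "(\<Sum>x\<in>h ` B. fscale (f x) x) = 0" and x: "x \<in> h ` B"
      then obtain b where b: "b \<in> B" "x = h b" by auto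
      have "h (lincomb (f \<circ> h) B) = 0"
        using f unfolding lin sum.reindex[OF injB] by (simp add: o_def)
      then have "lincomb (f \<circ> h) B = 0\<^sub>v n"
        using Ker.lincomb_closed[OF Bk, of "f \<circ> h"] mat_kernel_carrier[OF A]
        by (intro inj_onD[OF inj]) (auto simp: h_def fun_eq_iff)
      then show "f x = 0"
        using li b B(1) unfolding Ker.lin_dep_def by (auto simp: o_def)
    qed (use B in simp)
  qed simp
  then have "fv.dim (ker a {0..<n}) = kernel_dim A"
    using card_image[OF injB] Ker.dim_basis[OF B] by simp
  then show ?thesis
    using rank_plus_kernel_dim[OF A] unfolding rk_def A_def by simp
qed

section \<open>Cycles, components and the cyclomatic number\<close>

definition nbrs :: "(nat \<Rightarrow> nat \<Rightarrow> bool) \<Rightarrow> nat set \<Rightarrow> nat \<Rightarrow> nat set" where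
  "nbrs E W v = {u \<in> W. E v u}"

text \<open>Edges are confined to \<open>W\<close>, but reflexivity puts \<open>v\<close> into its
  own set even when \<open>v \<notin> W\<close>; hence the premise of
  \<open>co_subset\<close>.\<close>

definition reach_set :: "(nat \<Rightarrow> nat \<Rightarrow> bool) \<Rightarrow> nat set \<Rightarrow> nat \<Rightarrow> nat set" where
  "reach_set E W v = {w. (\<lambda>x y. E x y \<and> x \<in> W \<and> y \<in> W)\<^sup>*\<^sup>* v w}"

definition cyclomatic :: "(nat \<Rightarrow> nat \<Rightarrow> bool) \<Rightarrow> nat set \<Rightarrow> int" where
  "cyclomatic E W = int (card {{u, v} | u v. u \<in> W \<and> v \<in> W \<and> E u v}) - int (card W)
     + int (card (reach_set E W ` W))"

lemma theta_eq_cyclomatic: "theta n E = cyclomatic E {0..<n}"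
proof -
  have "{w. w < n \<and> (\<lambda>x y. E x y \<and> x < n \<and> y < n)\<^sup>*\<^sup>* v w}
    = reach_set E {0..<n} v" if "v < n" for v
  proof -
    have "w < n" if "(\<lambda>x y. E x y \<and> x < n \<and> y < n)\<^sup>*\<^sup>* v w" for w
      using that by (induction rule: rtranclp_induct) (use \<open>v < n\<close> in simp_all)
    moreover have "reach_set E {0..<n} v = {w. (\<lambda>x y. E x y \<and> x < n \<and> y < n)\<^sup>*\<^sup>* v w}"
      by (simp add: reach_set_def)
    ultimately show ?thesis by blast
  qed
  then have "num_components n E = card (reach_set E {0..<n} ` {0..<n})"
    unfolding num_components_def by (intro arg_cong[where f = card] image_cong) simp_all
  then show ?thesis unfolding theta_def cyclomatic_def edges_def by simp
qed

text \<open>Splitting off the closing edge removes \<open>mod\<close>, so that consecutive positions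
  can be handled by induction.\<close>

lemma is_cycle_iff:
  "is_cycle n E c \<longleftrightarrow> length c \<ge> 3 \<and> distinct c \<and> set c \<subseteq> {0..<n}
     \<and> (\<forall>i. Suc i < length c \<longrightarrow> E (c ! i) (c ! Suc i)) \<and> E (c ! (length c - 1)) (c ! 0)"
proof (cases "length c \<ge> 3")
  case True
  have "(\<forall>i<length c. E (c ! i) (c ! ((i + 1) mod length c))) \<longleftrightarrow>
     (\<forall>i. Suc i < length c \<longrightarrow> E (c ! i) (c ! Suc i)) \<and> E (c ! (length c - 1)) (c ! 0)"
    (is "?L \<longleftrightarrow> ?R")
  proof
    assume L: ?L
    have "E (c ! i) (c ! Suc i)" if "Suc i < length c" for i
      using L[rule_format, of i] that by simp
    moreover have "E (c ! (length c - 1)) (c ! 0)"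
    proof -
      have "Suc (length c - 1) = length c" using True by simp
      then show ?thesis using L[rule_format, of "length c - 1"] by simp
    qed
    ultimately show ?R by blast
  next
    assume R: ?R
    show ?L
    proof (intro allI impI)
      fix i assume "i < length c"
      show "E (c ! i) (c ! ((i + 1) mod length c))"
      proof (cases "Suc i < length c")
        case False
        then have "Suc i = length c" using \<open>i < length c\<close> by simp
        then have "i = length c - 1" "(i + 1) mod length c = 0" by simp_all
        then show ?thesis using R by simp
      qed (use R in simp)
    qed
  qed
  then show ?thesis unfolding is_cycle_def by simp
qed (simp add: is_cycle_def)

lemma cycle_edges_eq:
  assumes "length c \<ge> 3"
  shows "cycle_edges c = {{c ! i, c ! Suc i} | i. Suc i < length c} \<union> {{c ! (length c - 1), c ! 0}}"
proof -
  have "{{c ! i, c ! ((i + 1) mod length c)} | i. i < length c}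
    = (\<lambda>i. {c ! i, c ! ((i + 1) mod length c)}) ` {..<length c}" by auto
  also have "{..<length c} = insert (length c - 1) {i. Suc i < length c}" using assms by auto
  also have "(\<lambda>i. {c ! i, c ! ((i + 1) mod length c)}) ` insert (length c - 1) {i. Suc i < length c}
    = insert {c ! (length c - 1), c ! 0} ((\<lambda>i. {c ! i, c ! Suc i}) ` {i. Suc i < length c})"
  proof -
    have "Suc (length c - 1) = length c" using assms by simp
    then show ?thesis unfolding image_insert by (intro arg_cong2[where f = insert] image_cong) simp_all
  qed
  finally show ?thesis unfolding cycle_edges_def[symmetric]
    by (simp only: setcompr_eq_image Un_insert_right Un_empty_right)
qed

lemma nth_rotate_succ:
  assumes "i < length c"
  shows "rotate k c ! ((i + 1) mod length c) = c ! (((k + i) mod length c + 1) mod length c)"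
proof -
  have "(i + 1) mod length c < length c" using assms by (intro mod_less_divisor) linarith
  moreover have "(k + (i + 1) mod length c) mod length c = ((k + i) mod length c + 1) mod length c"
    by (metis mod_add_right_eq mod_add_left_eq add.assoc)
  ultimately show ?thesis by (simp only: nth_rotate)
qed

lemma is_cycle_rotate: "is_cycle n E c \<Longrightarrow> is_cycle n E (rotate k c)"
  unfolding is_cycle_def
proof (elim conjE, intro conjI allI impI)
  fix i
  assume "3 \<le> length c" and e: "\<forall>i<length c. E (c ! i) (c ! ((i + 1) mod length c))"
    and i: "i < length (rotate k c)"
  then have "(k + i) mod length c < length c" by (intro mod_less_divisor) linarith
  with e i show "E (rotate k c ! i) (rotate k c ! ((i + 1) mod length (rotate k c)))"
    by (simp only: length_rotate nth_rotate_succ nth_rotate)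
qed simp_all

lemma cycle_edges_rotate: "cycle_edges (rotate k c) = cycle_edges c"
proof (cases "c = []")
  case False
  have sub: "cycle_edges (rotate k c) \<subseteq> cycle_edges c" if "c \<noteq> []" for k and c :: "nat list"
  proof
    fix e assume "e \<in> cycle_edges (rotate k c)"
    then obtain i where i: "i < length c"
      and e: "e = {rotate k c ! i, rotate k c ! ((i + 1) mod length c)}"
      unfolding cycle_edges_def by auto
    have "(k + i) mod length c < length c" using that by simp
    moreover have "e = {c ! ((k + i) mod length c), c ! (((k + i) mod length c + 1) mod length c)}"
      using i unfolding e by (simp only: nth_rotate nth_rotate_succ)
    ultimately show "e \<in> cycle_edges c" unfolding cycle_edges_def by blast
  qed
  have "rotate (length c - k mod length c) (rotate k c) = c"
  proof -
    have "(length c - k mod length c + k) mod length c = 0"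
      using False by (metis le_add_diff_inverse2 length_greater_0_conv mod_add_right_eq
          mod_le_divisor mod_self)
    then show ?thesis by (simp add: rotate_rotate rotate_id)
  qed
  then show ?thesis using sub[of "rotate k c" "length c - k mod length c"] sub[of c k] False by auto
qed (simp add: cycle_edges_def)

text \<open>Rotation lets any vertex of a cycle take index 0 while vertex set, edge set and length
  stay the same.\<close>

lemma cycle_at:
  assumes "is_cycle n E c" "x \<in> set c"
  obtains c' where "is_cycle n E c'" "c' ! 0 = x" "set c' = set c" "cycle_edges c' = cycle_edges c"
    "length c' = length c"
proof -
  obtain i where i: "i < length c" "c ! i = x" using assms(2) by (metis in_set_conv_nth)
  then have "rotate i c ! 0 = x" by (subst nth_rotate) auto
  then show thesis
    using that[of "rotate i c"] is_cycle_rotate[OF assms(1)] cycle_edges_rotate by auto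
qed

lemma in_cycle_edges_set:
  assumes "{u, v} \<in> cycle_edges c"
  shows "v \<in> set c"
proof -
  obtain i where i: "i < length c" "{u, v} = {c ! i, c ! ((i + 1) mod length c)}"
    using assms unfolding cycle_edges_def by blast
  have "(i + 1) mod length c < length c" using i(1) by (intro mod_less_divisor) linarith
  then have "{c ! i, c ! ((i + 1) mod length c)} \<subseteq> set c" using i(1) by simp
  then show ?thesis using i(2) by blast
qed

text \<open>With \<open>x\<close> rotated to index 0, its cycle neighbours are the positions 1 and
  \<open>length - 1\<close>, distinct since the length is at least 3, and the positions in between
  form a path that avoids \<open>x\<close>. The edges appear as \<open>E x a\<close> and
  \<open>E b x\<close>, in the sense of traversal, because \<open>E\<close> is not assumed symmetric
  here.\<close>

lemma cycle_nbrs: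
  assumes c: "is_cycle n E c" and x: "x \<in> set c"
  obtains a b where "a \<noteq> b" "{y. {x, y} \<in> cycle_edges c} = {a, b}" "a \<in> set c - {x}" "b \<in> set c - {x}"
    "E x a" "E b x"
    "\<And>W w. set c \<subseteq> W \<Longrightarrow> w \<in> set c - {x} \<Longrightarrow> w \<in> reach_set E (W - {x}) a"
proof -
  obtain d where d: "is_cycle n E d" "d ! 0 = x" "set d = set c" "cycle_edges d = cycle_edges c"
    using cycle_at[OF c x] by metis
  let ?p = "length d"
  have p: "?p \<ge> 3" and dist: "distinct d" and step: "\<And>i. Suc i < ?p \<Longrightarrow> E (d ! i) (d ! Suc i)"
    and close: "E (d ! (?p - 1)) (d ! 0)"
    using d(1) unfolding is_cycle_iff by blast+
  have neq: "d ! i = d ! j \<longleftrightarrow> i = j" if "i < ?p" "j < ?p" for i j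
    using that dist by (simp add: nth_eq_iff_index_eq)
  have lt: "0 < ?p" "1 < ?p" "?p - 1 < ?p" using p by linarith+
  have x0: "d ! i = x \<longleftrightarrow> i = 0" if "i < ?p" for i using neq[OF that lt(1)] d(2) by simp
  have mem: "d ! i \<in> set c" if "i < ?p" for i using that d(3) nth_mem by blast
  show thesis
  proof (rule that[of "d ! 1" "d ! (?p - 1)"])
    show "d ! 1 \<noteq> d ! (?p - 1)" unfolding neq[OF lt(2,3)] using p by linarith
    show "d ! 1 \<in> set c - {x}" using x0[OF lt(2)] mem[OF lt(2)] by simp
    show "d ! (?p - 1) \<in> set c - {x}" using x0[OF lt(3)] mem[OF lt(3)] p by simp
    show "E x (d ! 1)" using step[of 0] p d(2) by simp
    show "E (d ! (?p - 1)) x" using close d(2) by simp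
    show "{y. {x, y} \<in> cycle_edges c} = {d ! 1, d ! (?p - 1)}"
    proof (intro equalityI subsetI)
      fix y assume "y \<in> {y. {x, y} \<in> cycle_edges c}"
      then have "{x, y} \<in> {{d ! i, d ! Suc i} | i. Suc i < ?p} \<union> {{d ! (?p - 1), d ! 0}}"
        using cycle_edges_eq[OF p] d(4) by simp
      then consider i where "Suc i < ?p" "{x, y} = {d ! i, d ! Suc i}"
        | "{x, y} = {d ! (?p - 1), d ! 0}" by blast
      then show "y \<in> {d ! 1, d ! (?p - 1)}"
      proof cases
        case 1
        then have "x = d ! i \<and> y = d ! Suc i \<or> x = d ! Suc i \<and> y = d ! i"
          by (auto simp: doubleton_eq_iff)
        moreover have "x \<noteq> d ! Suc i" using x0[OF 1(1)] by simp
        moreover have "i = 0" if "x = d ! i" using x0[of i] 1(1) that by simp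
        ultimately show ?thesis by auto
      next
        case 2
        then have "x = d ! (?p - 1) \<and> y = d ! 0 \<or> x = d ! 0 \<and> y = d ! (?p - 1)"
          by (auto simp: doubleton_eq_iff)
        moreover have "x \<noteq> d ! (?p - 1)" using x0[OF lt(3)] p by simp
        ultimately show ?thesis by auto
      qed
    next
      fix y assume "y \<in> {d ! 1, d ! (?p - 1)}"
      moreover have "{d ! 0, d ! Suc 0} \<in> cycle_edges d" "{d ! (?p - 1), d ! 0} \<in> cycle_edges d"
        unfolding cycle_edges_eq[OF p] using p by auto
      ultimately show "y \<in> {y. {x, y} \<in> cycle_edges c}" using d(2,4) by (auto simp: insert_commute)
    qed
    fix W w assume W: "set c \<subseteq> W" and "w \<in> set c - {x}"
    then obtain j where j: "j < ?p" "d ! j = w" "j \<noteq> 0" using d(2,3) by (metis DiffE in_set_conv_nth singletonI)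
    have "Suc i < ?p \<Longrightarrow> d ! Suc i \<in> reach_set E (W - {x}) (d ! 1)" for i
    proof (induction i)
      case (Suc i)
      have "d ! Suc i \<in> W - {x}" "d ! Suc (Suc i) \<in> W - {x}"
        using Suc.prems W x0[of "Suc i"] x0[of "Suc (Suc i)"] mem[of "Suc i"] mem[of "Suc (Suc i)"]
        by auto
      then show ?case using Suc step[of "Suc i"]
        unfolding reach_set_def by (auto intro: rtranclp.rtrancl_into_rtrancl)
    qed (simp add: reach_set_def)
    then show "w \<in> reach_set E (W - {x}) (d ! 1)" using j by (metis not0_implies_Suc)
  qed
qed

text \<open>The path grows at its front; if the new start already occurs, everything before that
  occurrence is cut off.\<close>

lemma rtranclp_distinct_path:
  assumes "R\<^sup>*\<^sup>* a b"
  obtains p where "p \<noteq> []" "hd p = a" "last p = b" "distinct p" "successively R p"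
    "\<And>w. w \<in> set p \<Longrightarrow> R\<^sup>*\<^sup>* a w"
proof -
  from assms have "\<exists>p. p \<noteq> [] \<and> hd p = a \<and> last p = b \<and> distinct p \<and> successively R p
    \<and> (\<forall>w\<in>set p. R\<^sup>*\<^sup>* a w)"
  proof (induction rule: converse_rtranclp_induct)
    case base
    show ?case by (rule exI[of _ "[b]"]) simp
  next
    case (step y z)
    then obtain p where p: "p \<noteq> []" "hd p = z" "last p = b" "distinct p" "successively R p"
      "\<forall>w\<in>set p. R\<^sup>*\<^sup>* z w" by blast
    have reach: "\<forall>w\<in>set p. R\<^sup>*\<^sup>* y w"
      using p(6) step.hyps(1) by (meson converse_rtranclp_into_rtranclp)
    show ?case
    proof (cases "y \<in> set p")
      case True
      then obtain xs ys where s: "p = xs @ y # ys" by (meson split_list)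
      show ?thesis
        by (rule exI[of _ "y # ys"]) (use p reach s in \<open>auto simp: successively_append_iff\<close>)
    next
      case False
      show ?thesis
        by (rule exI[of _ "y # p"])
          (use p reach False step.hyps(1) in \<open>auto simp: successively_Cons\<close>)
    qed
  qed
  then show thesis using that by blast
qed

section \<open>Edge and component counts under vertex deletion\<close>

locale graph =
  fixes n :: nat and E :: "nat \<Rightarrow> nat \<Rightarrow> bool"
  assumes simple: "simple_graph n E"
begin

lemma E_sym: "E u v \<Longrightarrow> E v u" and E_irrefl: "\<not> E u u" and E_less: "E u v \<Longrightarrow> u < n \<and> v < n"
  using simple by (auto simp: simple_graph_def)

abbreviation N where "N \<equiv> nbrs E"
abbreviation co where "co \<equiv> reach_set E"
abbreviation cyc where "cyc \<equiv> is_cycle n E"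
abbreviation \<theta> where "\<theta> \<equiv> cyclomatic E"

lemma co_refl [simp]: "v \<in> co W v"
  by (simp add: reach_set_def)

lemma co_sym:
  assumes "w \<in> co W v"
  shows "v \<in> co W w"
  using assms unfolding reach_set_def mem_Collect_eq
proof (induction rule: rtranclp_induct)
  case (step y z)
  then have zy: "E z y \<and> z \<in> W \<and> y \<in> W" using E_sym by blast
  show ?case by (rule converse_rtranclp_into_rtranclp[where b = y]) (rule zy, rule step.IH)
qed simp

lemma co_trans: "w \<in> co W v \<Longrightarrow> u \<in> co W w \<Longrightarrow> u \<in> co W v"
  unfolding reach_set_def by simp

lemma co_eq: "w \<in> co W v \<Longrightarrow> co W w = co W v"
  using co_sym co_trans by blast

lemma co_step: "w \<in> co W v \<Longrightarrow> E w u \<Longrightarrow> w \<in> W \<Longrightarrow> u \<in> W \<Longrightarrow> u \<in> co W v"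
  unfolding reach_set_def by (auto intro: rtranclp.rtrancl_into_rtrancl)

lemma co_subset: "v \<in> W \<Longrightarrow> co W v \<subseteq> W"
proof
  fix w assume "v \<in> W" "w \<in> co W v"
  from this(2) show "w \<in> W" unfolding reach_set_def mem_Collect_eq
    by (induction rule: rtranclp_induct) (use \<open>v \<in> W\<close> in simp_all)
qed

lemma co_mono: "S \<subseteq> W \<Longrightarrow> co S v \<subseteq> co W v"
  unfolding reach_set_def by (intro Collect_mono impI, erule rtranclp_mono[THEN predicate2D, rotated]) auto

lemma co_induct [consumes 1, case_names base step]:
  assumes "w \<in> co W v" "P v" "\<And>y z. y \<in> co W v \<Longrightarrow> E y z \<Longrightarrow> y \<in> W \<Longrightarrow> z \<in> W \<Longrightarrow> P y \<Longrightarrow> P z"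
  shows "P w"
  using assms(1) unfolding reach_set_def mem_Collect_eq
proof (induction rule: rtranclp_induct)
  case (step y z)
  then show ?case using assms(3)[of y z] by (simp add: reach_set_def)
qed (rule assms(2))

lemma finite_W: "W \<subseteq> {0..<n} \<Longrightarrow> finite W"
  using finite_subset finite_atLeastLessThan by blast

lemma finite_N: "W \<subseteq> {0..<n} \<Longrightarrow> finite (N W x)"
  unfolding nbrs_def by (rule finite_subset[OF _ finite_W]) auto

lemma N_iff: "u \<in> N W v \<longleftrightarrow> u \<in> W \<and> E v u"
  by (simp add: nbrs_def)

lemma deg_in_N: "deg_in E W v = card (N W v)"
  by (simp add: deg_in_def nbrs_def)

lemma card_edges_remove:
  assumes "W \<subseteq> {0..<n}" "x \<in> W"
  shows "card {{u, v} | u v. u \<in> W \<and> v \<in> W \<and> E u v}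
    = card {{u, v} | u v. u \<in> W - {x} \<and> v \<in> W - {x} \<and> E u v} + card (N W x)"
proof -
  let ?e = "\<lambda>W. {{u, v} | u v. u \<in> W \<and> v \<in> W \<and> E u v}"
  have "?e W = ?e (W - {x}) \<union> (\<lambda>u. {x, u}) ` N W x"
  proof (intro equalityI subsetI)
    fix e assume "e \<in> ?e W"
    then obtain u v where e: "e = {u, v}" "u \<in> W" "v \<in> W" "E u v" by blast
    consider "u = x" | "v = x" | "u \<noteq> x" "v \<noteq> x" by blast
    then show "e \<in> ?e (W - {x}) \<union> (\<lambda>u. {x, u}) ` N W x"
    proof cases
      case 1
      then have "e = {x, v}" "v \<in> N W x" using e by (auto simp: N_iff)
      then show ?thesis by blast
    next
      case 2
      then have "e = {x, u}" "u \<in> N W x" using e E_sym[of u v] by (auto simp: N_iff)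
      then show ?thesis by blast
    next
      case 3
      then show ?thesis using e by blast
    qed
  next
    fix e assume "e \<in> ?e (W - {x}) \<union> (\<lambda>u. {x, u}) ` N W x"
    then show "e \<in> ?e W"
    proof
      assume "e \<in> (\<lambda>u. {x, u}) ` N W x"
      then obtain u where "e = {x, u}" "u \<in> W" "E x u" by (auto simp: N_iff)
      then show ?thesis using assms(2) by blast
    next
      assume "e \<in> ?e (W - {x})"
      then obtain u v where "e = {u, v}" "u \<in> W" "v \<in> W" "E u v" by blast
      then show ?thesis by blast
    qed
  qed
  moreover have "?e (W - {x}) \<inter> (\<lambda>u. {x, u}) ` N W x = {}"
  proof -
    have "x \<notin> e" if "e \<in> ?e (W - {x})" for e
    proof -
      from that obtain u v where "e = {u, v}" "u \<in> W - {x}" "v \<in> W - {x}" by blast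
      then show ?thesis by simp
    qed
    then show ?thesis by (metis (no_types, lifting) disjoint_iff imageE insertI1)
  qed
  moreover have "finite (?e (W - {x}))"
    by (rule finite_subset[of _ "Pow W"]) (use finite_W[OF assms(1)] in auto)
  moreover have "inj_on (\<lambda>u. {x, u}) (N W x)" by (auto simp: inj_on_def doubleton_eq_iff)
  ultimately show ?thesis
    using finite_N[OF assms(1)] by (simp add: card_Un_disjoint card_image)
qed

text \<open>The components of \<open>W - {x}\<close> that contain neighbours of \<open>x\<close>
  merge with \<open>x\<close> into one component of \<open>W\<close>; all others, collected in
  \<open>?Q\<close>, are components of \<open>W\<close> as they stand.\<close>

lemma card_components_remove:
  assumes W: "W \<subseteq> {0..<n}" and x: "x \<in> W"
  shows "card (co W ` W) + card (co (W - {x}) ` N W x) = card (co (W - {x}) ` (W - {x})) + 1"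
proof -
  let ?S = "W - {x}"
  let ?Q = "co ?S ` {v \<in> ?S. co ?S v \<inter> N W x = {}}"
  have NS: "N W x \<subseteq> ?S" using E_irrefl by (auto simp: N_iff)
  have fin: "finite ?Q" "finite (co ?S ` N W x)" using finite_W[OF W] finite_N[OF W] by auto
  have S: "co ?S ` ?S = co ?S ` N W x \<union> ?Q"
  proof (intro equalityI subsetI)
    fix C assume "C \<in> co ?S ` ?S"
    then obtain v where v: "v \<in> ?S" "C = co ?S v" by blast
    show "C \<in> co ?S ` N W x \<union> ?Q"
    proof (cases "co ?S v \<inter> N W x = {}")
      case False
      then obtain y where "y \<in> co ?S v" "y \<in> N W x" by blast
      then show ?thesis using v(2) co_eq[of y ?S v] by blast
    qed (use v in blast)
  qed (use NS in blast)
  have dis: "co ?S ` N W x \<inter> ?Q = {}"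
  proof (rule ccontr)
    assume "co ?S ` N W x \<inter> ?Q \<noteq> {}"
    then obtain y v where "y \<in> N W x" "co ?S v \<inter> N W x = {}" "co ?S y = co ?S v" by blast
    then show False using co_refl[of y ?S] by blast
  qed
  have same: "co W v = co ?S v" if v: "v \<in> ?S" "co ?S v \<inter> N W x = {}" for v
  proof
    show "co W v \<subseteq> co ?S v"
    proof
      fix w assume "w \<in> co W v"
      then show "w \<in> co ?S v"
      proof (induction rule: co_induct)
        case (step y z)
        have "z \<noteq> x"
        proof
          assume "z = x"
          then have "y \<in> N W x" using step.hyps E_sym by (simp add: N_iff)
          then show False using step.IH v(2) by blast
        qed
        moreover have "y \<in> ?S" using step.IH co_subset[OF v(1)] by blast
        ultimately show ?case using step by (intro co_step[OF step.IH]) simp_all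
      qed simp
    qed
  qed (rule co_mono, blast)
  have Wc: "co W ` W = insert (co W x) ?Q"
  proof (intro equalityI subsetI)
    fix C assume "C \<in> co W ` W"
    then obtain v where v: "v \<in> W" "C = co W v" by blast
    show "C \<in> insert (co W x) ?Q"
    proof (cases "v = x \<or> co ?S v \<inter> N W x \<noteq> {}")
      case True
      have "x \<in> co W v"
      proof (cases "v = x")
        case False
        then obtain y where y: "y \<in> co ?S v" "y \<in> N W x" using True by blast
        then have 1: "y \<in> co W v" using co_mono[of ?S W] by blast
        have 2: "y \<in> W" "E y x" using y(2) E_sym[of x y] by (simp_all add: N_iff)
        show ?thesis by (rule co_step[OF 1 2(2,1) x])
      qed simp
      from co_eq[OF this] show ?thesis using v(2) by simp
    next
      case False
      then have "v \<in> ?S" "co ?S v \<inter> N W x = {}" using v(1) by auto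
      then show ?thesis using v(2) same[of v] by blast
    qed
  next
    fix C assume "C \<in> insert (co W x) ?Q"
    then consider "C = co W x" | v where "C = co ?S v" "v \<in> ?S" "co ?S v \<inter> N W x = {}" by blast
    then show "C \<in> co W ` W"
    proof cases
      case 2
      then show ?thesis using same[of v] by auto
    qed (use x in blast)
  qed
  have "co W x \<notin> ?Q"
  proof
    assume "co W x \<in> ?Q"
    then obtain v where "v \<in> ?S" "co W x = co ?S v" by blast
    then show False using co_subset[of v ?S] co_refl[of x W] by blast
  qed
  then show ?thesis unfolding S Wc using fin dis by (simp add: card_Un_disjoint)
qed

text \<open>Source of all later estimates: \<open>\<theta>\<close> falls by the number of neighbours
  of \<open>x\<close> that are redundant for representing the components they lie in.\<close>

lemma cyclomatic_remove:
  assumes "W \<subseteq> {0..<n}" "x \<in> W"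
  shows "\<theta> W = \<theta> (W - {x}) + int (card (N W x)) - int (card (co (W - {x}) ` N W x))"
proof -
  have "card W = card (W - {x}) + 1"
    using assms finite_W by (metis Suc_eq_plus1 card_Suc_Diff1)
  then show ?thesis
    using card_edges_remove[OF assms] card_components_remove[OF assms]
    unfolding cyclomatic_def by linarith
qed

lemma cyclomatic_remove_le:
  assumes "W \<subseteq> {0..<n}"
  shows "\<theta> (W - {x}) \<le> \<theta> W"
proof (cases "x \<in> W")
  case True
  then show ?thesis
    using cyclomatic_remove[OF assms True] card_image_le[OF finite_N[OF assms], of "co (W - {x})" x] by linarith
qed simp

lemma cyclomatic_remove_isolated:
  assumes "W \<subseteq> {0..<n}" "x \<in> W" "N W x = {}"
  shows "\<theta> (W - {x}) = \<theta> W"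
  using cyclomatic_remove[OF assms(1,2)] assms(3) by simp

lemma cyclomatic_mono:
  assumes "W \<subseteq> {0..<n}"
  shows "\<theta> (W - X) \<le> \<theta> W"
proof -
  have "finite (W \<inter> X)" using finite_W[OF assms] by simp
  then have "\<theta> (W - (W \<inter> X)) \<le> \<theta> W"
  proof (induction rule: finite_induct)
    case (insert x F)
    have "W - insert x F = (W - F) - {x}" by blast
    moreover have "W - F \<subseteq> {0..<n}" using assms by blast
    ultimately show ?case using insert.IH cyclomatic_remove_le[of "W - F" x] by simp
  qed simp
  then show ?thesis by (simp add: Diff_Int)
qed

lemma cyclomatic_empty: "\<theta> {} = 0"
  by (simp add: cyclomatic_def)

lemma cyclomatic_nonneg: "W \<subseteq> {0..<n} \<Longrightarrow> \<theta> W \<ge> 0"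
  using cyclomatic_mono[of W W] cyclomatic_empty by simp

text \<open>The two cycle neighbours of \<open>x\<close> stay connected along the rest of the cycle,
  so one of them is redundant in the count of components.\<close>

lemma cyclomatic_remove_cycle_vertex:
  assumes W: "W \<subseteq> {0..<n}" and c: "cyc c" "set c \<subseteq> W" and x: "x \<in> set c"
  shows "\<theta> (W - {x}) \<le> \<theta> W - 1"
proof -
  obtain a b where ab: "a \<noteq> b" "a \<in> set c - {x}" "b \<in> set c - {x}" "E x a" "E b x"
    "\<And>W w. set c \<subseteq> W \<Longrightarrow> w \<in> set c - {x} \<Longrightarrow> w \<in> co (W - {x}) a"
    using cycle_nbrs[OF c(1) x] by metis
  let ?f = "co (W - {x})"
  have N: "a \<in> N W x" "b \<in> N W x" using ab c(2) E_sym[of b x] by (auto simp: N_iff)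
  have "?f b = ?f a" using ab(6)[OF c(2) ab(3)] co_eq by blast
  then have "?f ` N W x = ?f ` (N W x - {a})" using N ab(1) by (auto simp: image_iff)
  then have "card (?f ` N W x) \<le> card (N W x - {a})"
    using card_image_le[of "N W x - {a}" ?f] finite_N[OF W] by simp
  also have "\<dots> = card (N W x) - 1" using N finite_N[OF W] by simp
  finally have "card (?f ` N W x) + 1 \<le> card (N W x)"
    using N finite_N[OF W, of x] card_gt_0_iff[of "N W x"] by auto
  moreover have "x \<in> W" using c x by blast
  ultimately show ?thesis using cyclomatic_remove[OF W, of x] by linarith
qed

text \<open>A simple path from \<open>a\<close> to \<open>b\<close> that avoids \<open>x\<close> is
  closed up through \<open>x\<close>; listing it as \<open>x # p\<close> makes \<open>{x, a}\<close>
  the first edge.\<close>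

lemma cycle_through:
  assumes W: "W \<subseteq> {0..<n}" and x: "x \<in> W" and a: "a \<in> N W x" and b: "b \<in> N W x"
    and "a \<noteq> b" and ab: "b \<in> co (W - {x}) a"
  obtains c where "cyc c" "set c \<subseteq> insert x (co (W - {x}) a)" "set c \<subseteq> W" "x \<in> set c"
    "{x, a} \<in> cycle_edges c"
proof -
  let ?S = "W - {x}"
  let ?R = "\<lambda>x y. E x y \<and> x \<in> ?S \<and> y \<in> ?S"
  have "?R\<^sup>*\<^sup>* a b" using ab by (simp add: reach_set_def)
  then obtain p where p: "p \<noteq> []" "hd p = a" "last p = b" "distinct p" "successively ?R p"
    and "\<And>w. w \<in> set p \<Longrightarrow> ?R\<^sup>*\<^sup>* a w"
    by (rule rtranclp_distinct_path) blast
  then have p6: "w \<in> co ?S a" if "w \<in> set p" for w using that by (simp add: reach_set_def)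
  have aS: "a \<in> ?S" using a E_irrefl by (auto simp: N_iff)
  have pS: "set p \<subseteq> ?S" using p6 co_subset[OF aS] by blast
  have len: "length p \<ge> 2"
  proof (rule ccontr)
    assume "\<not> 2 \<le> length p"
    then have "length p < 2" by linarith
    then obtain y where "p = [y]" using p(1) by (cases p) auto
    then show False using p(2,3) \<open>a \<noteq> b\<close> by simp
  qed
  let ?c = "x # p"
  have "cyc ?c" unfolding is_cycle_iff
  proof (intro conjI allI impI)
    show "3 \<le> length ?c" using len by simp
    show "distinct ?c" using p(4) pS by auto
    show "set ?c \<subseteq> {0..<n}" using pS x W by auto
    have "?c ! (length ?c - 1) = b" using p(1,3) by (simp add: last_conv_nth)
    then show "E (?c ! (length ?c - 1)) (?c ! 0)" using b E_sym[of x b] by (simp add: N_iff)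
    fix i assume i: "Suc i < length ?c"
    show "E (?c ! i) (?c ! Suc i)"
    proof (cases i)
      case 0
      then show ?thesis using p(1,2) a by (simp add: hd_conv_nth N_iff)
    next
      case (Suc j)
      then show ?thesis using p(5) i unfolding successively_conv_nth by simp
    qed
  qed
  moreover have "{x, a} \<in> cycle_edges ?c"
  proof -
    have "?c ! 0 = x" "?c ! Suc 0 = a" "Suc 0 < length ?c" using p(1,2) by (simp_all add: hd_conv_nth)
    then show ?thesis using len by (subst cycle_edges_eq) (auto intro: exI[of _ 0])
  qed
  ultimately show thesis using that[of ?c] p6 pS x by auto
qed

text \<open>Walk along \<open>c\<close> from the common vertex \<open>y\<close>: each edge taken
  also belongs to \<open>d\<close>, so the next vertex is common again.\<close>

lemma cycle_edges_subset:
  assumes c: "cyc c" and d: "cyc d" and "y \<in> set c" "y \<in> set d"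
    and N: "\<And>x. x \<in> set c \<inter> set d \<Longrightarrow> {y. {x, y} \<in> cycle_edges c} \<subseteq> {y. {x, y} \<in> cycle_edges d}"
  shows "cycle_edges c \<subseteq> cycle_edges d"
proof -
  obtain e where e: "cyc e" "e ! 0 = y" "set e = set c" "cycle_edges e = cycle_edges c"
    using cycle_at[OF c \<open>y \<in> set c\<close>] by metis
  have p: "length e \<ge> 3" using e(1) by (simp add: is_cycle_def)
  have step: "{e ! i, e ! Suc i} \<in> cycle_edges c" if "Suc i < length e" for i
    using that unfolding e(4)[symmetric] cycle_edges_eq[OF p] by blast
  have all: "i < length e \<Longrightarrow> e ! i \<in> set c \<inter> set d" for i
  proof (induction i)
    case 0
    then show ?case using e assms(3,4) by simp
  next
    case (Suc i)
    then have "{e ! i, e ! Suc i} \<in> cycle_edges d" using N[of "e ! i"] step[of i] by auto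
    then show ?case using in_cycle_edges_set Suc.prems e(3) nth_mem by blast
  qed
  show ?thesis
  proof
    fix s assume s: "s \<in> cycle_edges c"
    then have "s \<in> cycle_edges e" using e(4) by simp
    then obtain i where i: "i < length e" "s = {e ! i, e ! ((i + 1) mod length e)}"
      unfolding cycle_edges_def by blast
    then show "s \<in> cycle_edges d" using N[OF all[OF i(1)]] s by blast
  qed
qed

text \<open>By \<open>cycle_edges_subset\<close>, different cycles that meet have a common vertex
  \<open>x\<close> at which their neighbour pairs differ. These pairs contain at least three
  neighbours of \<open>x\<close>, each pair lies in one component of \<open>W - {x}\<close>, and so
  two neighbours are redundant.\<close>

lemma cyclomatic_remove_meeting_cycles:
  assumes W: "W \<subseteq> {0..<n}" and c: "cyc c" "set c \<subseteq> W" and d: "cyc d" "set d \<subseteq> W"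
    and "cycle_edges c \<noteq> cycle_edges d" "set c \<inter> set d \<noteq> {}"
  obtains x where "x \<in> set c" "\<theta> (W - {x}) \<le> \<theta> W - 2"
proof -
  obtain y where y: "y \<in> set c" "y \<in> set d" using assms by blast
  obtain x where x: "x \<in> set c" "x \<in> set d"
    and ne: "{y. {x, y} \<in> cycle_edges c} \<noteq> {y. {x, y} \<in> cycle_edges d}"
  proof -
    have "\<not> (\<forall>x\<in>set c \<inter> set d. {y. {x, y} \<in> cycle_edges c} = {y. {x, y} \<in> cycle_edges d})"
    proof
      assume "\<forall>x\<in>set c \<inter> set d. {y. {x, y} \<in> cycle_edges c} = {y. {x, y} \<in> cycle_edges d}"
      then have "cycle_edges c \<subseteq> cycle_edges d" "cycle_edges d \<subseteq> cycle_edges c"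
        using cycle_edges_subset[OF c(1) d(1) y] cycle_edges_subset[OF d(1) c(1) y(2,1)] by auto
      then show False using assms by blast
    qed
    then show thesis using that by blast
  qed
  let ?f = "co (W - {x})"
  obtain a b where ab: "a \<noteq> b" "{y. {x, y} \<in> cycle_edges c} = {a, b}" "a \<in> set c - {x}"
    "b \<in> set c - {x}" "E x a" "E b x"
    "\<And>W w. set c \<subseteq> W \<Longrightarrow> w \<in> set c - {x} \<Longrightarrow> w \<in> co (W - {x}) a"
    using cycle_nbrs[OF c(1) x(1)] by metis
  obtain a' b' where ab': "a' \<noteq> b'" "{y. {x, y} \<in> cycle_edges d} = {a', b'}" "a' \<in> set d - {x}"
    "b' \<in> set d - {x}" "E x a'" "E b' x"
    "\<And>W w. set d \<subseteq> W \<Longrightarrow> w \<in> set d - {x} \<Longrightarrow> w \<in> co (W - {x}) a'"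
    using cycle_nbrs[OF d(1) x(2)] by metis
  have eq: "?f b = ?f a" "?f b' = ?f a'"
    using ab(7)[OF c(2) ab(4)] ab'(7)[OF d(2) ab'(4)] co_eq by blast+
  have NW: "a \<in> N W x" "b \<in> N W x" "a' \<in> N W x" "b' \<in> N W x"
    using ab ab' c(2) d(2) E_sym[of b x] E_sym[of b' x] by (auto simp: N_iff)
  have "\<exists>u v. u \<noteq> v \<and> u \<in> N W x \<and> v \<in> N W x \<and> ?f u \<in> ?f ` (N W x - {u, v}) \<and> ?f v \<in> ?f ` (N W x - {u, v})"
  proof -
    \<comment> \<open>The dropped vertices are \<open>s\<close> and \<open>s'\<close>, represented
      by their partners \<open>t\<close> and \<open>t'\<close>. The premises ensure that neither
      partner is dropped; the case distinctions below only choose the naming that meets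
      them.\<close>
    have *: "\<exists>u v. u \<noteq> v \<and> u \<in> N W x \<and> v \<in> N W x \<and> ?f u \<in> ?f ` (N W x - {u, v}) \<and> ?f v \<in> ?f ` (N W x - {u, v})"
      if "s \<noteq> t" "s \<in> N W x" "t \<in> N W x" "?f s = ?f t" "s' \<noteq> t'" "s' \<in> N W x" "t' \<in> N W x"
        "?f s' = ?f t'" "s \<notin> {s', t'}" "s' \<noteq> t" for s t s' t'
    proof (intro exI conjI)
      show "s \<noteq> s'" using that by blast
      show "?f s \<in> ?f ` (N W x - {s, s'})"
        by (rule image_eqI[of _ _ t]) (use that in auto)
      show "?f s' \<in> ?f ` (N W x - {s, s'})"
        by (rule image_eqI[of _ _ t']) (use that in auto)
    qed (use that in auto)
    have "a \<notin> {a', b'} \<or> b \<notin> {a', b'}" using ne ab(1,2) ab'(1,2) by auto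
    then show ?thesis
    proof
      assume "a \<notin> {a', b'}"
      then have "a \<notin> {b', a'}" by blast
      show ?thesis
      proof (cases "a' = b")
        case True
        show ?thesis
          by (rule *[of a b b' a']) (use True \<open>a \<notin> {b', a'}\<close> ab(1) ab'(1) NW eq in simp_all)
      next
        case False
        show ?thesis
          by (rule *[of a b a' b']) (use False \<open>a \<notin> {a', b'}\<close> ab(1) ab'(1) NW eq in simp_all)
      qed
    next
      assume "b \<notin> {a', b'}"
      then have "b \<notin> {b', a'}" by blast
      show ?thesis
      proof (cases "a' = a")
        case True
        show ?thesis
          by (rule *[of b a b' a']) (use True \<open>b \<notin> {b', a'}\<close> ab(1) ab'(1) NW eq in simp_all)
      next
        case False
        show ?thesis
          by (rule *[of b a a' b']) (use False \<open>b \<notin> {a', b'}\<close> ab(1) ab'(1) NW eq in simp_all)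
      qed
    qed
  qed
  then obtain u v where uv: "u \<noteq> v" "u \<in> N W x" "v \<in> N W x"
    "?f u \<in> ?f ` (N W x - {u, v})" "?f v \<in> ?f ` (N W x - {u, v})" by blast
  have "?f ` N W x = ?f ` (N W x - {u, v})"
  proof -
    have "N W x = insert u (insert v (N W x - {u, v}))" using uv by blast
    then have "?f ` N W x = insert (?f u) (insert (?f v) (?f ` (N W x - {u, v})))"
      by (metis image_insert)
    then show ?thesis using uv(4,5) by (simp add: insert_absorb)
  qed
  then have "card (?f ` N W x) \<le> card (N W x - {u, v})"
    using card_image_le[of "N W x - {u, v}" ?f] finite_N[OF W] by simp
  moreover have "card (N W x) = card (N W x - {u, v}) + 2"
  proof -
    have "card (N W x - {u, v}) = card (N W x) - card {u, v}"
      using uv by (intro card_Diff_subset) auto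
    moreover have "card {u, v} \<le> card (N W x)" using uv finite_N[OF W] by (intro card_mono) auto
    ultimately show ?thesis using uv(1) by simp
  qed
  moreover have "x \<in> W" using c x by blast
  ultimately have "\<theta> (W - {x}) \<le> \<theta> W - 2" using cyclomatic_remove[OF W, of x] by linarith
  then show thesis using that x by blast
qed

text \<open>Move from \<open>k\<close> to a neighbour \<open>m\<close> and delete \<open>k\<close>.
  A pendant vertex found in the smaller graph is pendant in \<open>W\<close> too, unless it is
  adjacent to \<open>k\<close>; then it and \<open>m\<close> are two neighbours of \<open>k\<close>
  joined without \<open>k\<close>, which gives a cycle. The start \<open>k\<close> is exempted
  because it may itself be the pendant vertex, and in the induction the exemption of
  \<open>m\<close> keeps the two neighbours distinct.\<close>

lemma cycle_or_pendant:
  assumes "W \<subseteq> {0..<n}" "k \<in> W" "N W k \<noteq> {}"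
  shows "(\<exists>c. cyc c \<and> set c \<subseteq> co W k) \<or> (\<exists>v\<in>co W k - {k}. card (N W v) = 1)"
  using finite_W[OF assms(1)] assms
proof (induction "card W" arbitrary: W k rule: less_induct)
  case less
  let ?S = "W - {k}"
  obtain m where m: "m \<in> N W k" using less.prems by blast
  then have mW: "m \<in> W" "E k m" "E m k" "m \<noteq> k" using E_sym[of k m] E_irrefl by (auto simp: N_iff)
  have mk: "m \<in> co W k" using co_step[of k W k m] mW less.prems by simp
  have sub: "co ?S m \<subseteq> co W k"
    using co_mono[of ?S W m] co_eq[OF mk] by blast
  show ?case
  proof (cases "N ?S m = {}")
    case True
    then have "N W m = {k}" using mW less.prems by (auto simp: nbrs_def)
    then show ?thesis using mk mW by (intro disjI2 bexI[of _ m]) simp_all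
  next
    case False
    have "card ?S < card W" using less.prems by (meson card_Diff1_less)
    from less.hyps[OF this _ _ _ False] less.prems mW
    have "(\<exists>c. cyc c \<and> set c \<subseteq> co ?S m) \<or> (\<exists>v\<in>co ?S m - {m}. card (N ?S v) = 1)" by auto
    then show ?thesis
    proof
      assume "\<exists>v\<in>co ?S m - {m}. card (N ?S v) = 1"
      then obtain v where v: "v \<in> co ?S m" "v \<noteq> m" "card (N ?S v) = 1" by blast
      have vS: "v \<in> ?S" using v(1) co_subset[of m ?S] mW by blast
      show ?thesis
      proof (cases "E v k")
        case True
        then have "v \<in> N W k" using vS E_sym[of v k] by (simp add: N_iff)
        then obtain c where "cyc c" "set c \<subseteq> insert k (co ?S m)"
          using cycle_through[OF less.prems(2,3) m _ v(2)[symmetric] v(1)] by metis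
        then show ?thesis using sub co_refl[of k W] by blast
      next
        case False
        then have "N W v = N ?S v" by (auto simp: nbrs_def)
        then show ?thesis using v vS sub by (intro disjI2 bexI[of _ v]) auto
      qed
    qed (use sub in blast)
  qed
qed

subsection \<open>Cycles attached in one vertex\<close>

text \<open>Cycles are compared by edge sets, since rotated or reversed lists describe the same
  cycle.\<close>

definition disjoint_cycles :: "nat set \<Rightarrow> bool" where
  "disjoint_cycles W \<longleftrightarrow> (\<forall>c d. cyc c \<and> set c \<subseteq> W \<and> cyc d \<and> set d \<subseteq> W
     \<and> cycle_edges c \<noteq> cycle_edges d \<longrightarrow> set c \<inter> set d = {})"

text \<open>A chord would also qualify; for disjoint cycles \<open>exit_component_disjoint\<close>
  rules it out, as \<open>k\<close> lies in its own component.\<close>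

definition exit :: "nat set \<Rightarrow> nat list \<Rightarrow> nat \<Rightarrow> nat \<Rightarrow> bool" where
  "exit W c x k \<longleftrightarrow> cyc c \<and> set c \<subseteq> W \<and> x \<in> set c \<and> k \<in> N W x \<and> {x, k} \<notin> cycle_edges c"

text \<open>A second neighbour of \<open>x\<close> behind \<open>k\<close> would close a cycle
  through the edge \<open>{x, k}\<close>, which meets \<open>c\<close> in \<open>x\<close> without
  being \<open>c\<close>.\<close>

lemma exit_bridge:
  assumes W: "W \<subseteq> {0..<n}" and disj: "disjoint_cycles W" and ex: "exit W c x k"
    and v: "v \<in> N W x" "v \<in> co (W - {x}) k" shows "v = k"
proof (rule ccontr)
  assume "v \<noteq> k"
  have x: "x \<in> W" "k \<in> N W x" "x \<in> set c" using ex by (auto simp: exit_def)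
  obtain d where d: "cyc d" "set d \<subseteq> W" "x \<in> set d" "{x, k} \<in> cycle_edges d"
    using cycle_through[OF W x(1,2) v(1) \<open>v \<noteq> k\<close>[symmetric] v(2)] by metis
  then have "cycle_edges c \<noteq> cycle_edges d" using ex by (auto simp: exit_def)
  then have "set c \<inter> set d = {}" using disj d ex unfolding disjoint_cycles_def exit_def by blast
  then show False using x(3) d(3) by blast
qed

text \<open>What remains of \<open>c\<close> without \<open>x\<close> is connected and contains a
  cycle neighbour \<open>a\<close> of \<open>x\<close>. If the component met it, \<open>a\<close>
  would lie behind \<open>k\<close>, so \<open>a = k\<close> by \<open>exit_bridge\<close>, although
  \<open>{x, a}\<close> is a cycle edge and \<open>{x, k}\<close> is not.\<close>

lemma exit_component_disjoint:
  assumes W: "W \<subseteq> {0..<n}" and disj: "disjoint_cycles W" and ex: "exit W c x k"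
  shows "co (W - {x}) k \<inter> set c = {}"
proof (rule ccontr)
  let ?S = "W - {x}"
  assume "\<not> ?thesis"
  then obtain w where w: "w \<in> co ?S k" "w \<in> set c" by blast
  have k: "k \<in> ?S" using ex E_irrefl by (auto simp: exit_def N_iff)
  have c: "cyc c" "set c \<subseteq> W" "x \<in> set c" using ex by (auto simp: exit_def)
  obtain a b where ab: "{y. {x, y} \<in> cycle_edges c} = {a, b}" "a \<in> set c - {x}" "E x a"
    "\<And>W w. set c \<subseteq> W \<Longrightarrow> w \<in> set c - {x} \<Longrightarrow> w \<in> co (W - {x}) a"
    using cycle_nbrs[OF c(1,3)] by metis
  have "w \<noteq> x" using w(1) co_subset[OF k] by blast
  then have "w \<in> co ?S a" using ab(4)[OF c(2)] w(2) by blast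
  then have "a \<in> co ?S k" using w(1) co_sym co_trans by blast
  moreover have "a \<in> N W x" using ab(2,3) c(2) by (auto simp: N_iff)
  ultimately have "a = k" using exit_bridge[OF W disj ex] by blast
  then show False using ab(1) ex by (auto simp: exit_def)
qed

text \<open>A vertex other than \<open>k\<close> that becomes pendant behind the exit must have lost
  the neighbour \<open>x\<close>, which \<open>exit_bridge\<close> excludes; so
  \<open>cycle_or_pendant\<close> yields a cycle.\<close>

lemma exit_component_cycle:
  assumes W: "W \<subseteq> {0..<n}" and disj: "disjoint_cycles W" and np: "no_pendant E W"
    and ex: "exit W c x k"
  obtains d where "cyc d" "set d \<subseteq> co (W - {x}) k"
proof -
  let ?S = "W - {x}"
  have x: "x \<in> W" "k \<in> N W x" using ex by (auto simp: exit_def)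
  then have k: "k \<in> ?S" "E k x" using E_irrefl E_sym[of x k] by (auto simp: N_iff)
  have "N ?S k \<noteq> {}"
  proof
    assume "N ?S k = {}"
    then have "N W k = {x}" using k x by (auto simp: nbrs_def)
    then show False using np k by (auto simp: no_pendant_def deg_in_N)
  qed
  moreover have "?S \<subseteq> {0..<n}" using W by blast
  ultimately consider d where "cyc d" "set d \<subseteq> co ?S k"
    | v where "v \<in> co ?S k - {k}" "card (N ?S v) = 1"
    using cycle_or_pendant[of ?S k] k by blast
  then show thesis
  proof cases
    case (2 v)
    then have vS: "v \<in> ?S" using co_subset[OF k(1)] by blast
    have "card (N W v) \<noteq> 1" using np vS by (auto simp: no_pendant_def deg_in_N)
    then have "N W v \<noteq> N ?S v" using 2 by metis
    then have "E v x" by (auto simp: nbrs_def)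
    then have "v \<in> N W x" using vS E_sym[of v x] by (auto simp: N_iff)
    then show thesis using exit_bridge[OF W disj ex] 2(1) by blast
  qed (rule that)
qed

text \<open>Since the part behind the exit at \<open>y\<close> misses \<open>x\<close>, all of it is
  reached from \<open>y\<close> without \<open>x\<close>. The inclusion is proper because of
  \<open>y\<close>.\<close>

lemma exit_component_psubset:
  assumes y: "exit W d y l" "y \<in> co (W - {x}) k" "k \<in> W - {x}" and x: "x \<notin> co (W - {y}) l"
  shows "co (W - {y}) l \<subset> co (W - {x}) k"
proof
  have l: "l \<in> W - {y}" "E y l" using y(1) E_irrefl by (auto simp: exit_def N_iff)
  have yS: "y \<in> W - {x}" using y(2) co_subset[OF y(3)] by blast
  have lx: "l \<noteq> x" using x by (metis co_refl)
  have lB: "l \<in> co (W - {x}) k" by (rule co_step[OF y(2) l(2) yS]) (use l lx in blast)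
  show "co (W - {y}) l \<subseteq> co (W - {x}) k"
  proof
    fix u assume u: "u \<in> co (W - {y}) l"
    then show "u \<in> co (W - {x}) k"
    proof (induction rule: co_induct)
      case (step u v)
      have "v \<in> co (W - {y}) l" by (rule co_step[OF step.hyps(1-4)])
      then have "v \<noteq> x" "u \<noteq> x" using x step.hyps(1) by blast+
      then show ?case using step by (intro co_step[OF step.IH step.hyps(2)]) simp_all
    qed (rule lB)
  qed
  show "co (W - {y}) l \<noteq> co (W - {x}) k" using y(2) co_subset[OF l(1)] by blast
qed

text \<open>Behind either exit all of \<open>d\<close> is avoided. So \<open>w2\<close> is reached
  from \<open>w1\<close> via \<open>x\<close> without touching \<open>d\<close>, and one more step
  enters \<open>d\<close> at \<open>y2\<close>.\<close>

lemma exit_components_separate: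
  assumes W: "W \<subseteq> {0..<n}" and disj: "disjoint_cycles W"
    and e1: "exit W d y1 w1" and e2: "exit W d y2 w2" and "y1 \<noteq> y2"
    and x1: "x \<in> co (W - {y1}) w1" and x2: "x \<in> co (W - {y2}) w2"
  shows False
proof -
  have w1: "w1 \<in> W - {y1}" and w2: "w2 \<in> W - {y2}" "E w2 y2" and y: "y2 \<in> W" "y1 \<in> set d" "y2 \<in> set d"
    using e1 e2 E_irrefl E_sym[of y2 w2] by (auto simp: exit_def N_iff)
  have d1: "co (W - {y1}) w1 \<inter> set d = {}" and d2: "co (W - {y2}) w2 \<inter> set d = {}"
    using exit_component_disjoint[OF W disj] e1 e2 by blast+
  have "w2 \<in> co (W - {y2}) x" using x2 by (rule co_sym)
  then have in1: "w2 \<in> co (W - {y1}) w1"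
  proof (induction rule: co_induct)
    case (step u v)
    have "v \<in> co (W - {y2}) x" by (rule co_step[OF step.hyps(1-4)])
    then have "v \<in> co (W - {y2}) w2" using x2 co_trans by blast
    then have "v \<noteq> y1" using d2 y by blast
    moreover have "u \<noteq> y1" using step.IH d1 y by blast
    ultimately show ?case using step by (intro co_step[OF step.IH step.hyps(2)]) simp_all
  qed (rule x1)
  have "w2 \<in> W - {y1}" using in1 co_subset[OF w1] by blast
  then have "y2 \<in> co (W - {y1}) w1"
    by (rule co_step[OF in1 w2(2)]) (use y(1) \<open>y1 \<noteq> y2\<close> in simp)
  then show False using d1 y by blast
qed

text \<open>Among all edges leaving a cycle, one with the smallest component behind it leads to a cycle
  that no second vertex connects to the rest.\<close>

lemma end_cycle:
  assumes W: "W \<subseteq> {0..<n}" and disj: "disjoint_cycles W" and np: "no_pendant E W"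
    and v: "v \<in> W" "N W v \<noteq> {}"
  obtains c e where "cyc c" "set c \<subseteq> W" "e \<in> set c"
    "\<And>y w. y \<in> set c \<Longrightarrow> y \<noteq> e \<Longrightarrow> w \<in> N W y \<Longrightarrow> {y, w} \<in> cycle_edges c"
proof (cases "\<exists>c x k. exit W c x k")
  case False
  obtain c where c: "cyc c" "set c \<subseteq> W"
    using cycle_or_pendant[OF W v] co_subset[OF v(1)] np unfolding no_pendant_def deg_in_N by blast
  have "c \<noteq> []" using c(1) by (auto simp: is_cycle_def)
  then show thesis using that[of c "hd c"] c False by (auto simp: exit_def)
next
  case True
  let ?P = "\<lambda>(c, x, k). exit W c x k" and ?m = "\<lambda>(c :: nat list, x, k). card (co (W - {x}) k)"
  have "\<exists>t. ?P t" using True by auto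
  then obtain t where "?P t" and "\<And>s. ?P s \<Longrightarrow> ?m t \<le> ?m s"
    using exists_least_iff[of "\<lambda>m. \<exists>t. ?P t \<and> ?m t = m"] by (metis not_less)
  then obtain c x k where ex: "exit W c x k"
    and min: "\<And>d y l. exit W d y l \<Longrightarrow> card (co (W - {x}) k) \<le> card (co (W - {y}) l)"
    by (cases t) fastforce
  have k: "k \<in> W - {x}" using ex E_irrefl by (auto simp: exit_def N_iff)
  have fin: "finite (co (W - {x}) k)"
    using finite_subset[OF co_subset[OF k]] finite_W[OF W] by blast
  obtain d where d: "cyc d" "set d \<subseteq> co (W - {x}) k"
    using exit_component_cycle[OF W disj np ex] by blast
  have dW: "set d \<subseteq> W" using d(2) co_subset[OF k] by blast
  \<comment> \<open>Otherwise the part behind this exit of \<open>d\<close> would be smaller than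
    the minimal one. Hence all exits of \<open>d\<close> lead back to \<open>x\<close>, and they
    share one vertex.\<close>
  have sep: "x \<in> co (W - {y}) l" if "exit W d y l" for y l
  proof (rule ccontr)
    assume "x \<notin> co (W - {y}) l"
    moreover have "y \<in> co (W - {x}) k" using that d(2) by (auto simp: exit_def)
    ultimately have "card (co (W - {y}) l) < card (co (W - {x}) k)"
      using exit_component_psubset[OF that _ k] psubset_card_mono[OF fin] by blast
    then show False using min[OF that] by simp
  qed
  have uniq: "y1 = y2" if "exit W d y1 w1" "exit W d y2 w2" for y1 w1 y2 w2
    using exit_components_separate[OF W disj that] sep that by blast
  have "d \<noteq> []" using d(1) by (auto simp: is_cycle_def)
  show thesis
  proof (cases "\<exists>y w. exit W d y w")
    case True
    then obtain e w where e: "exit W d e w" by blast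
    show thesis
    proof (rule that[OF d(1) dW, of e])
      show "e \<in> set d" using e by (simp add: exit_def)
      fix y w assume "y \<in> set d" "y \<noteq> e" "w \<in> N W y"
      then show "{y, w} \<in> cycle_edges d" using uniq[OF e, of y w] d(1) dW by (auto simp: exit_def)
    qed
  next
    case False
    then show thesis using that[OF d(1) dW, of "hd d"] \<open>d \<noteq> []\<close> d(1) dW by (auto simp: exit_def)
  qed
qed

end

section \<open>Tight vertex sets\<close>

locale weighted_graph = graph n E + hermitian_entries a conj
  for n E and a :: "nat \<Rightarrow> nat \<Rightarrow> 'a::field" and conj +
  assumes a_nonzero: "a u v \<noteq> 0 \<longleftrightarrow> E u v"
begin

lemma a_diag: "a x x = 0"
  using a_nonzero[of x x] E_irrefl by blast

lemma sum_nbrs: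
  assumes "W \<subseteq> {0..<n}" "S \<subseteq> W" "\<And>v. v \<notin> S \<Longrightarrow> z v = 0"
  shows "(\<Sum>v\<in>S. a u v * z v) = (\<Sum>v\<in>N W u. a u v * z v)"
proof -
  have "(\<Sum>v\<in>S. a u v * z v) = (\<Sum>v\<in>W. a u v * z v)"
    using assms finite_W[OF assms(1)] by (intro sum.mono_neutral_left) auto
  also have "\<dots> = (\<Sum>v\<in>N W u. a u v * z v)"
    using a_nonzero finite_W[OF assms(1)] by (intro sum.mono_neutral_right) (auto simp: nbrs_def)
  finally show ?thesis .
qed

text \<open>The rows use neighbourhoods in the ambient \<open>W\<close>, which do not change when
  \<open>S\<close> shrinks; the zero extension of \<open>z\<close> makes this harmless.\<close>

lemma ker_iff:
  assumes "W \<subseteq> {0..<n}" "S \<subseteq> W"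
  shows "z \<in> ker a S \<longleftrightarrow> (\<forall>v. v \<notin> S \<longrightarrow> z v = 0) \<and> (\<forall>u\<in>S. (\<Sum>v\<in>N W u. a u v * z v) = 0)"
  using sum_nbrs[OF assms, of z] by (auto simp: ker_def)

text \<open>In the notation of \<open>rk_remove\<close> the change is
  \<open>1 - \<alpha> + \<beta>\<close> with \<open>\<alpha>\<close> and \<open>\<beta>\<close>
  exclusive. So it is 0, 1 or 2, and the two extremes are witnessed by kernel vectors.\<close>

lemma rk_remove_cases:
  assumes W: "W \<subseteq> {0..<n}" and x: "x \<in> W"
  shows "rk a W = rk a (W - {x}) \<longleftrightarrow> (\<exists>z\<in>ker a W. z x \<noteq> 0)"
    and "rk a W = rk a (W - {x}) + 2 \<longleftrightarrow> (\<exists>z\<in>ker a (W - {x}). (\<Sum>v\<in>N W x. a x v * z v) \<noteq> 0)"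
    and "rk a (W - {x}) \<le> rk a W" and "rk a W \<le> rk a (W - {x}) + 2"
proof -
  have eq: "(\<Sum>v\<in>W - {x}. a x v * z v) = (\<Sum>v\<in>N W x. a x v * z v)" if "z \<in> ker a (W - {x})" for z
    by (rule sum_nbrs[OF W]) (use that in \<open>auto simp: ker_def\<close>)
  let ?A = "\<exists>z\<in>ker a W. z x \<noteq> 0"
  let ?B = "\<exists>z\<in>ker a (W - {x}). (\<Sum>v\<in>N W x. a x v * z v) \<noteq> 0"
  have B: "(\<exists>z\<in>ker a (W - {x}). (\<Sum>v\<in>W - {x}. a x v * z v) \<noteq> 0) \<longleftrightarrow> ?B"
    using eq by (intro bex_cong) auto
  have r: "rk a W = rk a (W - {x}) + 1 - of_bool ?A + of_bool ?B" "\<not> (?A \<and> ?B)"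
    using rk_remove[OF finite_W[OF W] x a_diag] unfolding B by blast+
  show "rk a W = rk a (W - {x}) \<longleftrightarrow> ?A" "rk a W = rk a (W - {x}) + 2 \<longleftrightarrow> ?B"
    "rk a (W - {x}) \<le> rk a W" "rk a W \<le> rk a (W - {x}) + 2"
    using r by (cases ?A; cases ?B; simp)+
qed

lemma unit_in_ker:
  assumes "W \<subseteq> {0..<n}" "x \<in> W" "N W x = {}"
  shows "(\<lambda>v. if v = x then 1 else 0) \<in> ker a W"
proof -
  have "(\<Sum>v\<in>N W u. a u v * (if v = x then 1 else 0)) = 0" if "u \<in> W" for u
  proof (rule sum.neutral, intro ballI)
    fix v assume "v \<in> N W u"
    then have "v \<noteq> x" using assms(3) that E_sym[of u x] by (auto simp: nbrs_def)
    then show "a u v * (if v = x then 1 else 0) = 0" by simp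
  qed
  then show ?thesis using ker_iff[OF assms(1) subset_refl] assms(2) by auto
qed

lemma rk_isolated:
  assumes "W \<subseteq> {0..<n}" "x \<in> W" "N W x = {}"
  shows "rk a (W - {x}) = rk a W"
proof -
  have "\<exists>z\<in>ker a W. z x \<noteq> 0" by (rule bexI[OF _ unit_in_ker[OF assms]]) simp
  then show ?thesis using rk_remove_cases(1)[OF assms(1,2)] by simp
qed

text \<open>Without \<open>v\<close> the vertex \<open>u\<close> is isolated, so its unit vector is
  in the kernel, and row \<open>v\<close> does not annihilate it because
  \<open>a v u \<noteq> 0\<close>. Deleting \<open>v\<close> thus costs 2, and deleting
  \<open>u\<close> afterwards costs nothing.\<close>

lemma rk_pendant:
  assumes W: "W \<subseteq> {0..<n}" and u: "u \<in> W" and N: "N W u = {v}"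
  shows "rk a W = rk a (W - {u, v}) + 2"
proof -
  have v: "v \<in> W" "E u v" "E v u" "v \<noteq> u" using N E_sym[of u v] E_irrefl by (auto simp: nbrs_def)
  let ?S = "W - {v}"
  have S: "?S \<subseteq> {0..<n}" "u \<in> ?S" "N ?S u = {}" using W u v N by (auto simp: nbrs_def)
  let ?z = "\<lambda>w. if w = u then 1 else 0"
  have "(\<Sum>w\<in>N W v. a v w * ?z w) = a v u"
  proof -
    have "u \<in> N W v" using u v by (simp add: N_iff)
    then show ?thesis using finite_N[OF W, of v] by (simp add: if_distrib sum.delta cong: if_cong)
  qed
  then have "\<exists>z\<in>ker a ?S. (\<Sum>w\<in>N W v. a v w * z w) \<noteq> 0"
    using a_nonzero[of v u] v(3) by (intro bexI[OF _ unit_in_ker[OF S]]) simp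
  then have "rk a W = rk a ?S + 2" using rk_remove_cases(2)[OF W v(1)] by simp
  also have "rk a ?S = rk a (?S - {u})" using rk_isolated[OF S] by simp
  also have "?S - {u} = W - {u, v}" by blast
  finally show ?thesis .
qed

end

section \<open>Gains and ones as two weightings of one graph\<close>

locale gain_graph = graph +
  fixes phi :: "nat \<Rightarrow> nat \<Rightarrow> complex"
  assumes gain: "unit_gain E phi"
begin

definition ag :: "nat \<Rightarrow> nat \<Rightarrow> complex" where "ag u v = (if E u v then phi u v else 0)"
definition a1 :: "nat \<Rightarrow> nat \<Rightarrow> real" where "a1 u v = (if E u v then 1 else 0)"

lemma phi_unit: "E u v \<Longrightarrow> cmod (phi u v) = 1" and phi_cnj: "E u v \<Longrightarrow> phi v u = cnj (phi u v)"
  using gain by (auto simp: unit_gain_def)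

sublocale P: weighted_graph n E ag cnj
proof
  show "ag v u = cnj (ag u v)" for u v
    using phi_cnj[of u v] E_sym[of u v] E_sym[of v u] by (auto simp: ag_def)
  show "ag u v \<noteq> 0 \<longleftrightarrow> E u v" for u v using phi_unit[of u v] by (auto simp: ag_def)
qed simp_all

sublocale O: weighted_graph n E a1 "\<lambda>x. x"
proof
  show "a1 v u = a1 u v" for u v using E_sym[of u v] E_sym[of v u] by (auto simp: a1_def)
qed (auto simp: a1_def)

abbreviation rg where "rg \<equiv> rk ag"
abbreviation r1 where "r1 \<equiv> rk a1"

lemma gain_rank_eq: "int (gain_rank n E phi) = rg {0..<n}"
  unfolding gain_rank_def gain_adj_def rank_eq_rk[symmetric] by (simp add: ag_def[abs_def])

lemma graph_rank_eq: "int (graph_rank n E) = r1 {0..<n}"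
  unfolding graph_rank_def adj01_def rank_eq_rk[symmetric] by (simp add: a1_def[abs_def])

lemma rank_lower_bound: "W \<subseteq> {0..<n} \<Longrightarrow> rg W \<ge> r1 W - 2 * \<theta> W"
proof (induction "card W" arbitrary: W rule: less_induct)
  case less
  note W = less.prems
  have IH: "rg (W - X) \<ge> r1 (W - X) - 2 * \<theta> (W - X)" if "x \<in> W" "x \<in> X" for x X
  proof (rule less.hyps)
    show "card (W - X) < card W" using that finite_W[OF W] by (intro psubset_card_mono) auto
  qed (use W in blast)
  \<comment> \<open>A cycle vertex pays for a loss of up to 2 in \<open>r1\<close> with one unit of
    \<open>\<theta>\<close>; the other moves keep the difference of the ranks and do not raise
    \<open>\<theta>\<close>. By \<open>cycle_or_pendant\<close> one of them is always
    available.\<close>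
  consider c x where "cyc c" "set c \<subseteq> W" "x \<in> set c" | u v where "u \<in> W" "N W u = {v}"
    | x where "x \<in> W" "N W x = {}" | "W = {}"
  proof (cases "\<exists>x\<in>W. N W x \<noteq> {}")
    case True
    then obtain x where x: "x \<in> W" "N W x \<noteq> {}" by blast
    then consider c where "cyc c" "set c \<subseteq> W" | v where "v \<in> W" "card (N W v) = 1"
      using cycle_or_pendant[OF W x] co_subset[OF x(1)] by blast
    then show ?thesis
    proof cases
      case (1 c)
      then have "hd c \<in> set c" by (cases c) (auto simp: is_cycle_def)
      then show ?thesis using 1 that by blast
    next
      case (2 v)
      then show ?thesis using that by (metis card_1_singletonE)
    qed
  qed (use that in blast)
  then show ?case
  proof cases
    case (1 c x)
    then have x: "x \<in> W" by blast
    show ?thesis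
      using IH[OF x, of "{x}"] P.rk_remove_cases(3)[OF W x] O.rk_remove_cases(4)[OF W x]
        cyclomatic_remove_cycle_vertex[OF W 1] by simp
  next
    case (2 u v)
    show ?thesis
      using IH[OF 2(1), of "{u, v}"] P.rk_pendant[OF W 2] O.rk_pendant[OF W 2]
        cyclomatic_mono[OF W, of "{u, v}"] by simp
  next
    case (3 x)
    show ?thesis
      using IH[OF 3(1), of "{x}"] P.rk_isolated[OF W 3] O.rk_isolated[OF W 3]
        cyclomatic_remove_isolated[OF W 3] by simp
  next
    case 4
    then show ?thesis by (simp add: rk_empty cyclomatic_empty)
  qed
qed

section \<open>Consequences of equality\<close>

definition tight :: "nat set \<Rightarrow> bool" where
  "tight W \<longleftrightarrow> rg W = r1 W - 2 * \<theta> W"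

text \<open>With \<open>V = W - {x}\<close>, the chain \<open>rg W \<ge> rg V \<ge> r1 V - 2 *
  \<theta> V \<ge> (r1 W - 2) - 2 * (\<theta> W - 1)\<close> ends in \<open>rg W\<close> itself, so
  every link is an equality.\<close>

lemma tight_cycle_vertex:
  assumes W: "W \<subseteq> {0..<n}" and "tight W" and c: "cyc c" "set c \<subseteq> W" "x \<in> set c"
  shows "tight (W - {x})" "\<theta> (W - {x}) = \<theta> W - 1" "rg W = rg (W - {x})" "r1 W = r1 (W - {x}) + 2"
proof -
  have x: "x \<in> W" using c by blast
  have "W - {x} \<subseteq> {0..<n}" using W by blast
  then show "tight (W - {x})" "\<theta> (W - {x}) = \<theta> W - 1" "rg W = rg (W - {x})" "r1 W = r1 (W - {x}) + 2"
    using rank_lower_bound[of "W - {x}"] P.rk_remove_cases(3)[OF W x] O.rk_remove_cases(4)[OF W x]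
      cyclomatic_remove_cycle_vertex[OF W c] \<open>tight W\<close> unfolding tight_def by linarith+
qed

lemma tight_disjoint_cycles:
  assumes W: "W \<subseteq> {0..<n}" and "tight W"
  shows "disjoint_cycles W"
  unfolding disjoint_cycles_def
proof (intro allI impI, elim conjE, rule ccontr)
  fix c d assume cd: "cyc c" "set c \<subseteq> W" "cyc d" "set d \<subseteq> W" "cycle_edges c \<noteq> cycle_edges d"
    "set c \<inter> set d \<noteq> {}"
  obtain x where x: "x \<in> set c" "\<theta> (W - {x}) \<le> \<theta> W - 2"
    using cyclomatic_remove_meeting_cycles[OF W cd] by blast
  then show False using tight_cycle_vertex(2)[OF assms cd(1,2) x(1)] by simp
qed

lemma tight_isolated:
  assumes "W \<subseteq> {0..<n}" "x \<in> W" "N W x = {}" "tight W"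
  shows "tight (W - {x})"
  using P.rk_isolated[OF assms(1-3)] O.rk_isolated[OF assms(1-3)]
    cyclomatic_remove_isolated[OF assms(1-3)] assms(4) by (simp add: tight_def)

text \<open>A cycle through \<open>v\<close> would give \<open>rg W = rg (W - {v})\<close>, and then
  also \<open>rg W = rg (W - {u, v})\<close> because \<open>u\<close> has become isolated; but a
  pendant vertex and its neighbour account for rank 2. The vertex \<open>u\<close> has too few
  neighbours for a cycle.\<close>

lemma tight_pendant:
  assumes W: "W \<subseteq> {0..<n}" and u: "u \<in> W" "N W u = {v}" and "tight W"
  shows "tight (W - {u, v})" "\<theta> (W - {u, v}) = \<theta> W" "cyc c \<Longrightarrow> set c \<subseteq> W \<Longrightarrow> set c \<subseteq> W - {u, v}"
proof -
  have "W - {u, v} \<subseteq> {0..<n}" using W by blast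
  then show "tight (W - {u, v})" "\<theta> (W - {u, v}) = \<theta> W"
    using rank_lower_bound[of "W - {u, v}"] P.rk_pendant[OF W u] O.rk_pendant[OF W u]
      cyclomatic_mono[OF W, of "{u, v}"] \<open>tight W\<close> unfolding tight_def by linarith+
  assume c: "cyc c" "set c \<subseteq> W"
  have "u \<notin> set c"
  proof
    assume "u \<in> set c"
    then obtain a b where "a \<noteq> b" "a \<in> set c - {u}" "b \<in> set c - {u}" "E u a" "E b u"
      using cycle_nbrs[OF c(1)] by metis
    then have "a \<in> N W u" "b \<in> N W u" using c(2) E_sym[of b u] by (auto simp: N_iff)
    then show False using u(2) \<open>a \<noteq> b\<close> by simp
  qed
  moreover have "v \<notin> set c"
  proof
    assume v: "v \<in> set c"
    have "v \<in> W" "v \<noteq> u" using v c(2) calculation by blast+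
    then have S: "W - {v} \<subseteq> {0..<n}" "u \<in> W - {v}" "N (W - {v}) u = {}"
      using W u by (auto simp: nbrs_def)
    have "W - {v} - {u} = W - {u, v}" by blast
    then have "rg W = rg (W - {u, v})"
      using tight_cycle_vertex(3)[OF W \<open>tight W\<close> c v] P.rk_isolated[OF S] by simp
    then show False using P.rk_pendant[OF W u] by simp
  qed
  ultimately show "set c \<subseteq> W - {u, v}" using c(2) by blast
qed

lemma delta_stepE:
  assumes "delta_step E W W'" "W \<subseteq> {0..<n}"
  obtains u v where "u \<in> W" "N W u = {v}" "W' = W - {u, v}"
proof -
  obtain u v where uv: "u \<in> W" "v \<in> W" "card (N W u) = 1" "E u v" "W' = W - {u, v}"
    using assms(1) unfolding delta_step_def deg_in_N by blast
  then have "v \<in> N W u" by (simp add: N_iff)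
  moreover obtain w where "N W u = {w}" using uv(3) by (rule card_1_singletonE)
  ultimately have "N W u = {v}" by simp
  then show thesis using that[of u v] uv(1,5) by simp
qed

lemma delta_stepI: "u \<in> W \<Longrightarrow> N W u = {v} \<Longrightarrow> delta_step E W (W - {u, v})"
proof -
  assume u: "u \<in> W" "N W u = {v}"
  then have "v \<in> W \<and> E u v" using N_iff[of v W u] by simp
  with u have "u \<in> W \<and> v \<in> W \<and> card (N W u) = 1 \<and> E u v \<and> W - {u, v} = W - {u, v}" by simp
  then show ?thesis unfolding delta_step_def deg_in_N by blast
qed

text \<open>The invariance of the difference needs no tightness, so it also serves the converse
  direction.\<close>

lemma delta_steps_rank:
  assumes "(delta_step E)\<^sup>*\<^sup>* W W'" "W \<subseteq> {0..<n}"
  shows "W' \<subseteq> W \<and> rg W' - r1 W' = rg W - r1 W"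
  using assms(1)
proof (induction rule: rtranclp_induct)
  case (step S T)
  then have S: "S \<subseteq> {0..<n}" using assms(2) by blast
  obtain u v where uv: "u \<in> S" "N S u = {v}" "T = S - {u, v}" using delta_stepE[OF step.hyps(2) S] .
  then show ?case using step.IH P.rk_pendant[OF S uv(1,2)] O.rk_pendant[OF S uv(1,2)] by auto
qed simp

lemma delta_steps_tight:
  assumes "(delta_step E)\<^sup>*\<^sup>* W W'" "W \<subseteq> {0..<n}" "tight W"
  shows "W' \<subseteq> W \<and> tight W' \<and> \<theta> W' = \<theta> W"
  using assms(1)
proof (induction rule: rtranclp_induct)
  case (step S T)
  then have S: "S \<subseteq> {0..<n}" using assms(2) by blast
  obtain u v where uv: "u \<in> S" "N S u = {v}" "T = S - {u, v}" using delta_stepE[OF step.hyps(2) S] .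
  then show ?case using step.IH tight_pendant(1,2)[OF S uv(1,2)] by auto
qed (simp add: assms)

end

section \<open>Kernels on attached cycles\<close>

context graph
begin

text \<open>The attachment vertex is fixed as index 0, to be arranged by rotation; it may have any
  number of further edges, or none.\<close>

definition attached_at :: "nat set \<Rightarrow> nat list \<Rightarrow> bool" where
  "attached_at W c \<longleftrightarrow> cyc c \<and> set c \<subseteq> W
     \<and> (\<forall>y\<in>set c. y \<noteq> c ! 0 \<longrightarrow> (\<forall>w\<in>N W y. {y, w} \<in> cycle_edges c))"

definition component_cycle :: "nat set \<Rightarrow> nat list \<Rightarrow> bool" where
  "component_cycle W c \<longleftrightarrow> cyc c \<and> set c \<subseteq> W \<and> (\<forall>y\<in>set c. \<forall>w\<in>N W y. {y, w} \<in> cycle_edges c)"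

lemma component_cycle_attached: "component_cycle W c \<Longrightarrow> attached_at W c"
  by (auto simp: component_cycle_def attached_at_def)

lemma cycle_edge_at_Suc:
  assumes c: "cyc c" and i: "Suc i < length c" and e: "{c ! Suc i, w} \<in> cycle_edges c"
  shows "w = c ! i \<or> w = c ! (Suc (Suc i) mod length c)"
proof -
  have p: "length c \<ge> 3" and dist: "distinct c" using c by (auto simp: is_cycle_def)
  have neq: "c ! k = c ! j \<longleftrightarrow> k = j" if "k < length c" "j < length c" for k j
    using that dist by (simp add: nth_eq_iff_index_eq)
  have "{c ! Suc i, w} \<in> {{c ! j, c ! Suc j} | j. Suc j < length c} \<union> {{c ! (length c - 1), c ! 0}}"
    using e cycle_edges_eq[OF p] by simp
  then consider j where "Suc j < length c" "{c ! Suc i, w} = {c ! j, c ! Suc j}"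
    | "{c ! Suc i, w} = {c ! (length c - 1), c ! 0}" by blast
  then show ?thesis
  proof cases
    case (1 j)
    then have "c ! Suc i = c ! j \<and> w = c ! Suc j \<or> c ! Suc i = c ! Suc j \<and> w = c ! j"
      by (simp add: doubleton_eq_iff)
    then have "Suc i = j \<and> w = c ! Suc j \<or> Suc i = Suc j \<and> w = c ! j"
      using neq[OF i, of j] neq[OF i 1(1)] 1(1) by auto
    then show ?thesis using 1(1) by auto
  next
    case 2
    then have "c ! Suc i = c ! (length c - 1) \<and> w = c ! 0 \<or> c ! Suc i = c ! 0"
      by (auto simp: doubleton_eq_iff)
    moreover have "length c - 1 < length c" "0 < length c" using p by linarith+
    ultimately have "Suc i = length c - 1 \<and> w = c ! 0"
      using neq[OF i, of "length c - 1"] neq[OF i, of 0] by auto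
    then have "Suc (Suc i) = length c" "w = c ! 0" using p by linarith+
    then show ?thesis by simp
  qed
qed

lemma cycle_edge_at_0:
  assumes c: "cyc c" and e: "{c ! 0, w} \<in> cycle_edges c"
  shows "w = c ! 1 \<or> w = c ! (length c - 1)"
proof -
  have p: "length c \<ge> 3" and dist: "distinct c" using c by (auto simp: is_cycle_def)
  have lt: "0 < length c" "length c - 1 < length c" using p by linarith+
  have neq: "c ! k = c ! j \<longleftrightarrow> k = j" if "k < length c" "j < length c" for k j
    using that dist by (simp add: nth_eq_iff_index_eq)
  have "{c ! 0, w} \<in> {{c ! j, c ! Suc j} | j. Suc j < length c} \<union> {{c ! (length c - 1), c ! 0}}"
    using e cycle_edges_eq[OF p] by simp
  then consider j where "Suc j < length c" "{c ! 0, w} = {c ! j, c ! Suc j}"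
    | "{c ! 0, w} = {c ! (length c - 1), c ! 0}" by blast
  then show ?thesis
  proof cases
    case (1 j)
    then have "c ! 0 = c ! j \<and> w = c ! Suc j \<or> c ! 0 = c ! Suc j \<and> w = c ! j"
      by (simp add: doubleton_eq_iff)
    then have "j = 0 \<and> w = c ! Suc j" using neq[OF lt(1), of j] neq[OF lt(1) 1(1)] 1(1) by auto
    then show ?thesis by simp
  next
    case 2
    then have "c ! 0 = c ! (length c - 1) \<and> w = c ! 0 \<or> w = c ! (length c - 1)"
      by (simp add: doubleton_eq_iff)
    then show ?thesis by auto
  qed
qed

text \<open>The index \<open>Suc i\<close> keeps away from the attachment vertex. That the two
  neighbours differ turns the kernel row into a sum of exactly two terms.\<close>

lemma attached_nbrs:
  assumes c: "attached_at W c" and i: "Suc i < length c"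
  shows "N W (c ! Suc i) = {c ! i, c ! (Suc (Suc i) mod length c)}" "c ! i \<noteq> c ! (Suc (Suc i) mod length c)"
proof -
  have cy: "cyc c" and sub: "set c \<subseteq> W" using c by (auto simp: attached_at_def)
  have p: "length c \<ge> 3" and dist: "distinct c" using cy by (auto simp: is_cycle_def)
  have lt: "i < length c" "0 < length c" "Suc (Suc i) mod length c < length c" using i p
    by (linarith, linarith, intro mod_less_divisor) linarith
  have "c ! Suc i \<noteq> c ! 0" using nth_eq_iff_index_eq[OF dist i lt(2)] by simp
  then have "\<forall>w\<in>N W (c ! Suc i). {c ! Suc i, w} \<in> cycle_edges c"
    using c i nth_mem[OF i] by (auto simp: attached_at_def)
  moreover have "E (c ! i) (c ! Suc i)" using cy i by (simp add: is_cycle_iff)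
  moreover have "E (c ! Suc i) (c ! (Suc (Suc i) mod length c))"
    using cy i unfolding is_cycle_def by simp
  ultimately show "N W (c ! Suc i) = {c ! i, c ! (Suc (Suc i) mod length c)}"
    using cycle_edge_at_Suc[OF cy i] sub E_sym[of "c ! i" "c ! Suc i"] nth_mem[OF lt(1)] nth_mem[OF lt(3)]
    unfolding nbrs_def by blast
  have "i \<noteq> Suc (Suc i) mod length c"
  proof (cases "Suc (Suc i) < length c")
    case False
    then have "Suc (Suc i) = length c" using i by linarith
    then show ?thesis using p by auto
  qed simp
  then show "c ! i \<noteq> c ! (Suc (Suc i) mod length c)"
    using nth_eq_iff_index_eq[OF dist lt(1,3)] by simp
qed

lemma component_nbrs_0:
  assumes c: "component_cycle W c"
  shows "N W (c ! 0) = {c ! 1, c ! (length c - 1)}" "c ! 1 \<noteq> c ! (length c - 1)"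
proof -
  have cy: "cyc c" and sub: "set c \<subseteq> W" using c by (auto simp: component_cycle_def)
  have p: "length c \<ge> 3" and dist: "distinct c" using cy by (auto simp: is_cycle_def)
  have lt: "0 < length c" "1 < length c" "length c - 1 < length c" using p by linarith+
  have "\<forall>w\<in>N W (c ! 0). {c ! 0, w} \<in> cycle_edges c"
    using c nth_mem[OF lt(1)] by (auto simp: component_cycle_def)
  moreover have "E (c ! 0) (c ! 1)" "E (c ! (length c - 1)) (c ! 0)"
    using cy lt(2) by (auto simp: is_cycle_iff)
  ultimately show "N W (c ! 0) = {c ! 1, c ! (length c - 1)}"
    using cycle_edge_at_0[OF cy] sub E_sym[of "c ! (length c - 1)" "c ! 0"] nth_mem[OF lt(2)] nth_mem[OF lt(3)]
    unfolding nbrs_def by blast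
  show "c ! 1 \<noteq> c ! (length c - 1)" using nth_eq_iff_index_eq[OF dist lt(2,3)] p by simp
qed

end

context gain_graph
begin

text \<open>Starting at \<open>s = 0\<close> removes the attachment vertex \<open>c ! 0\<close>, starting at \<open>s = 1\<close> keeps it.\<close>

lemma peel:
  assumes c: "attached_at W c"
  shows "s \<le> 1 \<Longrightarrow> s + 2 * j < length c \<Longrightarrow>
    (delta_step E)\<^sup>*\<^sup>* (W - {c ! s}) (W - (!) c ` {s..s + 2 * j})"
proof (induction j)
  case (Suc j)
  let ?i = "s + 2 * j" and ?S = "W - (!) c ` {s..s + 2 * j}"
  have cy: "cyc c" and sub: "set c \<subseteq> W" using c by (auto simp: attached_at_def)
  have dist: "distinct c" using cy by (auto simp: is_cycle_def)
  have i: "Suc (Suc ?i) < length c" using Suc.prems by simp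
  have mem: "c ! k \<in> ?S" if "?i < k" "k < length c" for k
  proof -
    have "c ! k \<noteq> c ! l" if "l \<in> {s..?i}" for l
      using nth_eq_iff_index_eq[OF dist, of k l] that \<open>?i < k\<close> \<open>k < length c\<close> by simp
    then show ?thesis using nth_mem[OF that(2)] sub by blast
  qed
  \<comment> \<open>The deleted stretch ends at \<open>c ! ?i\<close>, so its successor has become
    pendant; that vertex and its remaining neighbour form the next pair.\<close>
  have "N W (c ! Suc ?i) = {c ! ?i, c ! Suc (Suc ?i)}"
    using attached_nbrs(1)[OF c, of ?i] i by simp
  moreover have "c ! ?i \<notin> ?S" by simp
  moreover have "c ! Suc (Suc ?i) \<in> ?S" using mem i by simp
  moreover have "N ?S (c ! Suc ?i) = N W (c ! Suc ?i) \<inter> ?S" by (auto simp: nbrs_def)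
  ultimately have "N ?S (c ! Suc ?i) = {c ! Suc (Suc ?i)}" by auto
  moreover have "c ! Suc ?i \<in> ?S" using mem i by simp
  ultimately have "delta_step E ?S (?S - {c ! Suc ?i, c ! Suc (Suc ?i)})"
    by (intro delta_stepI)
  moreover have "?S - {c ! Suc ?i, c ! Suc (Suc ?i)} = W - (!) c ` {s..s + 2 * Suc j}"
  proof -
    have "{s..s + 2 * Suc j} = {s..?i} \<union> {Suc ?i, Suc (Suc ?i)}" by auto
    then show ?thesis by auto
  qed
  ultimately show ?case using Suc by (auto intro: rtranclp.rtrancl_into_rtrancl)
qed simp

text \<open>Deleting \<open>c ! 0\<close> leaves a path on \<open>length c - 1\<close> vertices,
  which is peeled in pairs. For even length its last vertex remains, isolated because both its
  neighbours are gone.\<close>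

lemma peel_to_rest:
  assumes W: "W \<subseteq> {0..<n}" and c: "attached_at W c"
  obtains T where "(delta_step E)\<^sup>*\<^sup>* (W - {c ! 0}) T"
    "T = W - set c \<or> (\<exists>y\<in>T. N T y = {} \<and> T - {y} = W - set c)"
proof -
  have cy: "cyc c" and sub: "set c \<subseteq> W" using c by (auto simp: attached_at_def)
  have dist: "distinct c" and p: "length c \<ge> 3" using cy by (auto simp: is_cycle_def)
  have set: "set c = (!) c ` {0..length c - 1}"
  proof -
    have "{0..length c - 1} = {0..<length c}" using p by auto
    then show ?thesis unfolding set_conv_nth by auto
  qed
  show thesis
  proof (cases "even (length c)")
    case False
    then obtain j where j: "length c = 2 * j + 1" by (rule oddE)
    then show thesis using peel[OF c, of 0 j] that set by simp
  next
    case True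
    then obtain j' where "length c = 2 * j'" by (rule evenE)
    then obtain j where j: "length c = 2 * j + 2" using p by (cases j') auto
    let ?T = "W - (!) c ` {0..2 * j}" and ?y = "c ! (2 * j + 1)"
    have "(!) c ` {0..length c - 1} = insert ?y ((!) c ` {0..2 * j})"
    proof -
      have "{0..length c - 1} = insert (2 * j + 1) {0..2 * j}" using j by auto
      then show ?thesis by simp
    qed
    then have TW: "?T - {?y} = W - set c" using set by auto
    have "?y \<noteq> c ! k" if "k \<in> {0..2 * j}" for k
      using nth_eq_iff_index_eq[OF dist, of "2 * j + 1" k] that j by simp
    then have "?y \<notin> (!) c ` {0..2 * j}" by blast
    moreover have "?y \<in> W" using nth_mem[of "2 * j + 1" c] sub j by auto
    ultimately have yT: "?y \<in> ?T" by blast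
    have "N W ?y = {c ! (2 * j), c ! 0}"
      using attached_nbrs(1)[OF c, of "2 * j"] j by simp
    moreover have "N ?T ?y = N W ?y \<inter> ?T" by (auto simp: nbrs_def)
    moreover have "c ! (2 * j) \<notin> ?T" "c ! 0 \<notin> ?T" by auto
    ultimately have "N ?T ?y = {}" by simp
    then have "\<exists>y\<in>?T. N ?T y = {} \<and> ?T - {y} = W - set c" using TW by (intro bexI[OF _ yT] conjI)
    then show thesis using peel[OF c, of 0 j] that[of ?T] j by simp
  qed
qed

end

context graph
begin

lemma attached_no_exit:
  assumes "attached_at W c" "w \<in> set c" "w \<noteq> c ! 0" "u \<in> N W w"
  shows "u \<in> set c"
proof -
  have "{w, u} \<in> cycle_edges c" using assms unfolding attached_at_def by blast
  then show ?thesis by (rule in_cycle_edges_set)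
qed

lemma attached_N_outside:
  assumes c: "attached_at W c" and u: "u \<in> W - set c"
  shows "N (W - {c ! 0}) u = N (W - set c) u"
proof -
  have "c ! 0 \<in> set c" using c by (intro nth_mem) (auto simp: attached_at_def is_cycle_def)
  moreover have "w \<notin> set c" if "w \<in> W - {c ! 0}" "E u w" for w
  proof
    assume "w \<in> set c"
    moreover have "u \<in> N W w" using u that E_sym[of u w] by (simp add: N_iff)
    ultimately show False using attached_no_exit[OF c] that u by blast
  qed
  ultimately show ?thesis unfolding nbrs_def by blast
qed

end

context weighted_graph
begin

lemma attached_row:
  assumes W: "W \<subseteq> {0..<n}" and c: "attached_at W c" and z: "z \<in> ker a S" "S \<subseteq> W"
    and i: "Suc i < length c" "c ! Suc i \<in> S"
  shows "a (c ! Suc i) (c ! i) * z (c ! i)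
    + a (c ! Suc i) (c ! (Suc (Suc i) mod length c)) * z (c ! (Suc (Suc i) mod length c)) = 0"
proof -
  have "(\<Sum>v\<in>N W (c ! Suc i). a (c ! Suc i) v * z v) = 0"
    using z(1) ker_iff[OF W z(2)] i(2) by blast
  then show ?thesis using attached_nbrs[OF c i(1)] by simp
qed

text \<open>Deleting \<open>c ! 0\<close> separates the remaining cycle from
  \<open>W - set c\<close>: rows of cycle vertices see only zeros of \<open>z\<close>, and the other
  rows are unchanged.\<close>

lemma ker_restrict_iff:
  assumes W: "W \<subseteq> {0..<n}" and c: "attached_at W c" and supp: "\<And>v. v \<notin> W - set c \<Longrightarrow> z v = 0"
  shows "z \<in> ker a (W - {c ! 0}) \<longleftrightarrow> z \<in> ker a (W - set c)"
proof -
  let ?K = "W - set c" and ?S = "W - {c ! 0}"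
  have S: "?S \<subseteq> {0..<n}" "?K \<subseteq> {0..<n}" using W by blast+
  have c0: "c ! 0 \<in> set c" using c by (intro nth_mem) (auto simp: attached_at_def is_cycle_def)
  have same: "(\<Sum>v\<in>N ?S u. a u v * z v) = (\<Sum>v\<in>N ?K u. a u v * z v)" if "u \<in> ?K" for u
    using attached_N_outside[OF c that] by simp
  have zero: "(\<Sum>v\<in>N ?S u. a u v * z v) = 0" if "u \<in> ?S - ?K" for u
  proof (rule sum.neutral, intro ballI)
    fix v assume v: "v \<in> N ?S u"
    then have "v \<in> N W u" by (simp add: N_iff)
    moreover have "u \<in> set c" "u \<noteq> c ! 0" using that by blast+
    ultimately have "v \<in> set c" using attached_no_exit[OF c] by blast
    then show "a u v * z v = 0" using supp by simp
  qed
  have "(\<forall>u\<in>?S. (\<Sum>v\<in>N ?S u. a u v * z v) = 0) \<longleftrightarrow> (\<forall>u\<in>?K. (\<Sum>v\<in>N ?K u. a u v * z v) = 0)"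
  proof (intro iffI ballI)
    fix u assume *: "\<forall>u\<in>?S. (\<Sum>v\<in>N ?S u. a u v * z v) = 0" and u: "u \<in> ?K"
    then have "u \<in> ?S" using c0 by blast
    with * show "(\<Sum>v\<in>N ?K u. a u v * z v) = 0" unfolding same[OF u, symmetric] by (rule bspec)
  next
    fix u assume *: "\<forall>u\<in>?K. (\<Sum>v\<in>N ?K u. a u v * z v) = 0" and u: "u \<in> ?S"
    show "(\<Sum>v\<in>N ?S u. a u v * z v) = 0"
    proof (cases "u \<in> ?K")
      case True
      with * show ?thesis unfolding same[OF True] by (rule bspec)
    qed (use zero u in blast)
  qed
  moreover have "\<forall>v. v \<notin> ?S \<longrightarrow> z v = 0" "\<forall>v. v \<notin> ?K \<longrightarrow> z v = 0" using supp c0 by auto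
  ultimately show ?thesis
    unfolding ker_iff[OF S(1) subset_refl] ker_iff[OF S(2) subset_refl] by blast
qed

text \<open>On a component cycle only the rows of the cycle itself need checking, since all other
  rows miss the support. Letting \<open>S\<close> be smaller than \<open>W\<close> covers the graph
  with \<open>c ! 0\<close> deleted, where \<open>f\<close> has to vanish at 0.\<close>

lemma cycle_vector_in_ker:
  assumes W: "W \<subseteq> {0..<n}" and c: "component_cycle W c" and S: "S \<subseteq> W"
    and supp: "\<And>i. i < length c \<Longrightarrow> c ! i \<notin> S \<Longrightarrow> f i = 0"
    and row: "\<And>i. Suc i < length c \<Longrightarrow> c ! Suc i \<in> S \<Longrightarrow> a (c ! Suc i) (c ! i) * f i
      + a (c ! Suc i) (c ! (Suc (Suc i) mod length c)) * f (Suc (Suc i) mod length c) = 0"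
    and row0: "c ! 0 \<in> S \<Longrightarrow> a (c ! 0) (c ! 1) * f 1 + a (c ! 0) (c ! (length c - 1)) * f (length c - 1) = 0"
  obtains z where "z \<in> ker a S" "\<And>i. i < length c \<Longrightarrow> z (c ! i) = f i"
proof -
  have cy: "cyc c" and sub: "set c \<subseteq> W" using c by (auto simp: component_cycle_def)
  have dist: "distinct c" and p: "length c \<ge> 3" using cy by (auto simp: is_cycle_def)
  have lt: "1 < length c" "length c - 1 < length c" using p by linarith+
  \<comment> \<open>As \<open>c\<close> is distinct, at most one summand is nonzero; the sum avoids
    inverting the indexing.\<close>
  define z where "z v = (\<Sum>i<length c. if c ! i = v then f i else 0)" for v
  have zc: "z (c ! i) = f i" if "i < length c" for i
  proof -
    have "z (c ! i) = (\<Sum>j<length c. if j = i then f j else 0)"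
      unfolding z_def using that dist by (intro sum.cong) (simp_all add: nth_eq_iff_index_eq)
    then show ?thesis using that by simp
  qed
  have z0: "z v = 0" if "v \<notin> set c" for v
    unfolding z_def by (rule sum.neutral) (use that nth_mem in auto)
  have "z \<in> ker a S"
    unfolding ker_iff[OF W S]
  proof (intro conjI allI impI ballI)
    fix v assume "v \<notin> S"
    show "z v = 0"
    proof (cases "v \<in> set c")
      case True
      then obtain i where "i < length c" "c ! i = v" by (auto simp: in_set_conv_nth)
      then show ?thesis using zc supp \<open>v \<notin> S\<close> by metis
    qed (rule z0)
  next
    fix u assume u: "u \<in> S"
    show "(\<Sum>v\<in>N W u. a u v * z v) = 0"
    proof (cases "u \<in> set c")
      case False
      show ?thesis
      proof (rule sum.neutral, intro ballI)
        fix v assume v: "v \<in> N W u"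
        have "v \<notin> set c"
        proof
          assume "v \<in> set c"
          moreover have "u \<in> N W v" using v u S E_sym[of u v] by (auto simp: N_iff)
          ultimately have "{v, u} \<in> cycle_edges c" using c unfolding component_cycle_def by blast
          then show False using in_cycle_edges_set False by blast
        qed
        then show "a u v * z v = 0" using z0 by simp
      qed
    next
      case True
      then obtain i where i: "i < length c" "c ! i = u" by (auto simp: in_set_conv_nth)
      show ?thesis
      proof (cases i)
        case 0
        then show ?thesis using component_nbrs_0[OF c] row0 u i zc lt by auto
      next
        case (Suc j)
        have "Suc (Suc j) mod length c < length c" using p by (intro mod_less_divisor) linarith
        then show ?thesis
          using attached_nbrs[OF component_cycle_attached[OF c], of j] row[of j] u i Suc zc by auto
      qed
    qed
  qed
  then show thesis using that zc by blast
qed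

end

section \<open>Reading length and gain off kernel vectors\<close>

context gain_graph
begin

lemma alternate:
  assumes W: "W \<subseteq> {0..<n}" and c: "attached_at W c" and z: "z \<in> ker a1 (W - {c ! 0})"
  shows "s + 2 * j \<le> length c \<Longrightarrow> z (c ! ((s + 2 * j) mod length c)) = (-1) ^ j * z (c ! (s mod length c))"
proof (induction j)
  case (Suc j)
  let ?i = "s + 2 * j"
  have i: "Suc ?i < length c" using Suc.prems by simp
  have cy: "cyc c" and sub: "set c \<subseteq> W" using c by (auto simp: attached_at_def)
  have dist: "distinct c" using cy by (auto simp: is_cycle_def)
  have "0 < length c" using i by linarith
  then have "c ! Suc ?i \<noteq> c ! 0" using nth_eq_iff_index_eq[OF dist i, of 0] by simp
  then have mem: "c ! Suc ?i \<in> W - {c ! 0}" using nth_mem[OF i] sub by blast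
  have nb: "N W (c ! Suc ?i) = {c ! ?i, c ! (Suc (Suc ?i) mod length c)}"
    by (rule attached_nbrs(1)[OF c i])
  have "c ! ?i \<in> N W (c ! Suc ?i)" "c ! (Suc (Suc ?i) mod length c) \<in> N W (c ! Suc ?i)"
    unfolding nb by simp_all
  then have one: "a1 (c ! Suc ?i) (c ! ?i) = 1"
    "a1 (c ! Suc ?i) (c ! (Suc (Suc ?i) mod length c)) = 1"
    by (simp_all only: N_iff a1_def if_True)
  have "z (c ! ?i) + z (c ! (Suc (Suc ?i) mod length c)) = 0"
    using O.attached_row[OF W c z Diff_subset i mem] unfolding one mult_1 .
  then have "z (c ! (Suc (Suc ?i) mod length c)) = - z (c ! ?i)" by linarith
  also have "c ! ?i = c ! (?i mod length c)" using i by simp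
  also have "z (c ! (?i mod length c)) = (-1) ^ j * z (c ! (s mod length c))"
    by (rule Suc.IH) (use i in simp)
  also have "Suc (Suc ?i) = s + 2 * Suc j" by simp
  finally show ?case by simp
qed simp

end

context graph
begin

lemma sum_nbrs_attachment:
  assumes W: "W \<subseteq> {0..<n}" and c: "attached_at W c"
    and "\<And>v. v \<in> N W (c ! 0) \<Longrightarrow> v \<in> set c \<Longrightarrow> f v = 0"
  shows "(\<Sum>v\<in>N W (c ! 0). f v) = (\<Sum>v\<in>N (insert (c ! 0) (W - set c)) (c ! 0). f v)"
proof (rule sum.mono_neutral_right[OF finite_N[OF W]])
  have "c ! 0 \<in> set c" using c by (intro nth_mem) (auto simp: attached_at_def is_cycle_def)
  then have "c ! 0 \<in> W" using c by (auto simp: attached_at_def)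
  then show "N (insert (c ! 0) (W - set c)) (c ! 0) \<subseteq> N W (c ! 0)" by (auto simp: nbrs_def)
  show "\<forall>v\<in>N W (c ! 0) - N (insert (c ! 0) (W - set c)) (c ! 0). f v = 0"
    using assms(3) by (auto simp: nbrs_def)
qed

end

context gain_graph
begin

text \<open>Deleting \<open>c ! 0\<close> costs one unit of \<open>\<theta>\<close>; peeling the
  remaining path and dropping a leftover isolated vertex cost none.\<close>

lemma tight_rest:
  assumes W: "W \<subseteq> {0..<n}" and "tight W" and c: "attached_at W c"
  shows "tight (W - set c)" "\<theta> (W - set c) = \<theta> W - 1"
proof -
  have cy: "cyc c" "set c \<subseteq> W" using c by (auto simp: attached_at_def)
  have c0: "c ! 0 \<in> set c" using cy(1) by (intro nth_mem) (auto simp: is_cycle_def)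
  note v = tight_cycle_vertex[OF W \<open>tight W\<close> cy c0]
  obtain T where T: "(delta_step E)\<^sup>*\<^sup>* (W - {c ! 0}) T"
    "T = W - set c \<or> (\<exists>y\<in>T. N T y = {} \<and> T - {y} = W - set c)"
    using peel_to_rest[OF W c] by blast
  have S: "W - {c ! 0} \<subseteq> {0..<n}" using W by blast
  have t: "T \<subseteq> {0..<n}" "tight T" "\<theta> T = \<theta> W - 1"
    using delta_steps_tight[OF T(1) S v(1)] v(2) S by auto
  have "tight (W - set c) \<and> \<theta> (W - set c) = \<theta> W - 1"
    using T(2)
  proof (elim disjE bexE conjE)
    fix y assume y: "y \<in> T" "N T y = {}" "T - {y} = W - set c"
    show ?thesis
      using tight_isolated[OF t(1) y(1,2) t(2)] cyclomatic_remove_isolated[OF t(1) y(1,2)] t(3)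
      unfolding y(3) by simp
  qed (use t in simp)
  then show "tight (W - set c)" "\<theta> (W - set c) = \<theta> W - 1" by blast+
qed

text \<open>For odd length the real vector that witnesses the drop of \<open>r1\<close> at
  \<open>c ! 0\<close> vanishes at both cycle neighbours, so it acts off the cycle. There
  \<open>r1\<close> rises by 2 when \<open>c ! 0\<close> is added to the rest, tightness of the rest
  forces \<open>rg\<close> to do the same, and the complex witness contradicts
  \<open>rg W = rg (W - {c ! 0})\<close>.\<close>

lemma tight_even_cycle:
  assumes W: "W \<subseteq> {0..<n}" and "tight W" and c: "attached_at W c"
  shows "even (length c)"
proof (rule ccontr)
  assume odd: "odd (length c)"
  let ?e = "c ! 0" and ?K = "W - set c"
  let ?H = "insert ?e ?K"
  have cy: "cyc c" "set c \<subseteq> W" using c by (auto simp: attached_at_def)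
  have p: "length c \<ge> 3" and dist: "distinct c" using cy by (auto simp: is_cycle_def)
  have lt: "0 < length c" "1 < length c" using p by linarith+
  have e: "?e \<in> set c" "?e \<in> W" using nth_mem[OF lt(1)] cy by auto
  have H: "?H \<subseteq> {0..<n}" "?e \<in> ?H" "?H - {?e} = ?K" using W e by auto
  note v = tight_cycle_vertex[OF W \<open>tight W\<close> cy e(1)]
  note K = tight_rest[OF W \<open>tight W\<close> c]
  from iffD1[OF O.rk_remove_cases(2)[OF W e(2)] v(4)]
  obtain z where z: "z \<in> ker a1 (W - {?e})" "(\<Sum>v\<in>N W ?e. a1 ?e v * z v) \<noteq> 0" by (rule bexE)
  have ze: "z ?e = 0" by (rule ker_outside[OF z(1)]) simp
  obtain j where j: "length c = 2 * j + 1" using odd by (rule oddE)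
  \<comment> \<open>In steps of two, position 1 leads to position 0, and position 0 to the last
    position; \<open>z\<close> vanishes at 0.\<close>
  have "z (c ! ((1 + 2 * j) mod length c)) = (-1) ^ j * z (c ! (1 mod length c))"
    by (rule alternate[OF W c z(1)]) (unfold j, linarith)
  moreover have "(1 + 2 * j) mod length c = 0" unfolding j by simp
  moreover have "1 mod length c = 1" by (rule mod_less[OF lt(2)])
  ultimately have "z (c ! 0) = (-1) ^ j * z (c ! 1)" by (simp only:)
  then have z1: "z (c ! 1) = 0"
    unfolding ze by (metis mult_eq_0_iff power_eq_0_iff zero_neq_neg_one)
  have "z (c ! ((0 + 2 * j) mod length c)) = (-1) ^ j * z (c ! (0 mod length c))"
    by (rule alternate[OF W c z(1)]) (unfold j, linarith)
  moreover have "(0 + 2 * j) mod length c = length c - 1" unfolding j by simp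
  moreover have "0 mod length c = 0" by simp
  ultimately have "z (c ! (length c - 1)) = (-1) ^ j * z (c ! 0)" by (simp only:)
  then have zl: "z (c ! (length c - 1)) = 0" unfolding ze mult_zero_right .
  have zc: "z v = 0" if "v \<in> N W ?e" "v \<in> set c" for v
  proof -
    have "v \<noteq> ?e" using that E_irrefl by (auto simp: N_iff)
    moreover have "?e \<in> N W v" using that e E_sym[of ?e v] by (simp add: N_iff)
    ultimately have "{v, ?e} \<in> cycle_edges c" using c that(2) unfolding attached_at_def by blast
    then have "{?e, v} \<in> cycle_edges c" by (simp add: insert_commute)
    then show ?thesis using cycle_edge_at_0[OF cy(1)] z1 zl by blast
  qed
  \<comment> \<open>The nonzero value of row \<open>?e\<close> comes entirely from outside the
    cycle, so it survives restriction to \<open>?K\<close>.\<close>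
  define y where "y v = (if v \<in> ?K then z v else 0)" for v
  have "y \<in> ker a1 ?K"
  proof -
    have S: "W - {?e} \<subseteq> {0..<n}" "?K \<subseteq> {0..<n}" using W by blast+
    have row: "(\<Sum>v\<in>N ?K u. a1 u v * y v) = 0" if u: "u \<in> ?K" for u
    proof -
      have "(\<Sum>v\<in>N ?K u. a1 u v * y v) = (\<Sum>v\<in>N (W - {?e}) u. a1 u v * z v)"
        unfolding attached_N_outside[OF c u] by (intro sum.cong) (auto simp: y_def nbrs_def)
      also have "\<dots> = 0"
      proof -
        have "u \<in> W - {?e}" using u e(1) by blast
        then show ?thesis using z(1) O.ker_iff[OF S(1) subset_refl, of z] by blast
      qed
      finally show ?thesis .
    qed
    have "y v = 0" if "v \<notin> ?K" for v using that by (simp only: y_def if_False)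
    with row show ?thesis unfolding O.ker_iff[OF S(2) subset_refl] by blast
  qed
  moreover have "(\<Sum>v\<in>N ?H ?e. a1 ?e v * y v) = (\<Sum>v\<in>N W ?e. a1 ?e v * z v)"
  proof -
    have "(\<Sum>v\<in>N W ?e. a1 ?e v * z v) = (\<Sum>v\<in>N ?H ?e. a1 ?e v * z v)"
    proof (rule sum_nbrs_attachment[OF W c, where f = "\<lambda>v. a1 ?e v * z v"])
      fix v assume "v \<in> N W ?e" "v \<in> set c"
      then show "a1 ?e v * z v = 0" by (simp only: zc mult_zero_right)
    qed
    also have "\<dots> = (\<Sum>v\<in>N ?H ?e. a1 ?e v * y v)"
    proof (rule sum.cong[OF refl])
      fix v assume "v \<in> N ?H ?e"
      then have "v \<in> ?K" using E_irrefl by (auto simp: N_iff)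
      then show "a1 ?e v * z v = a1 ?e v * y v" by (simp only: y_def if_True)
    qed
    finally show ?thesis by simp
  qed
  ultimately have "\<exists>y\<in>ker a1 ?K. (\<Sum>v\<in>N ?H ?e. a1 ?e v * y v) \<noteq> 0"
    using z(2) by (intro bexI[of _ y]) simp_all
  from iffD2[OF O.rk_remove_cases(2)[OF H(1,2), unfolded H(3)] this]
  have "r1 ?H = r1 ?K + 2" .
  \<comment> \<open>\<open>?H\<close> misses \<open>c ! 1\<close>, so \<open>\<theta> ?H\<close> is
    at most \<open>\<theta> ?K\<close>, and the lower bound at \<open>?H\<close> forces the maximal
    rise of \<open>rg\<close>.\<close>
  moreover have "\<theta> ?H \<le> \<theta> W - 1"
  proof -
    have "c ! 1 \<noteq> ?e" using nth_eq_iff_index_eq[OF dist lt(2,1)] by simp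
    then have "?H = (W - {c ! 1}) - (set c - {?e})" using e nth_mem[OF lt(2)] by auto
    moreover have "W - {c ! 1} \<subseteq> {0..<n}" using W by blast
    ultimately have "\<theta> ?H \<le> \<theta> (W - {c ! 1})" using cyclomatic_mono by metis
    then show ?thesis using cyclomatic_remove_cycle_vertex[OF W cy nth_mem[OF lt(2)]] by linarith
  qed
  moreover have "rg ?H \<le> rg ?K + 2" using P.rk_remove_cases(4)[OF H(1,2)] unfolding H(3) .
  ultimately have "rg ?H = rg ?K + 2"
    using rank_lower_bound[OF H(1)] K unfolding tight_def by linarith
  from iffD1[OF P.rk_remove_cases(2)[OF H(1,2), unfolded H(3)] this]
  obtain x where x: "x \<in> ker ag ?K" "(\<Sum>v\<in>N ?H ?e. ag ?e v * x v) \<noteq> 0" by (rule bexE)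
  have xs: "v \<notin> ?K \<Longrightarrow> x v = 0" for v by (rule ker_outside[OF x(1)])
  \<comment> \<open>Extended by zero over the cycle, \<open>x\<close> witnesses a change of
    \<open>rg\<close> by 2 at \<open>?e\<close> in \<open>W\<close>, where tightness allows
    none.\<close>
  have "x \<in> ker ag (W - {?e})" using P.ker_restrict_iff[OF W c xs] x(1) by (rule iffD2)
  moreover have "(\<Sum>v\<in>N W ?e. ag ?e v * x v) \<noteq> 0"
  proof -
    have "(\<Sum>v\<in>N W ?e. ag ?e v * x v) = (\<Sum>v\<in>N ?H ?e. ag ?e v * x v)"
    proof (rule sum_nbrs_attachment[OF W c, where f = "\<lambda>v. ag ?e v * x v"])
      fix v assume "v \<in> set c"
      then have "x v = 0" by (intro xs) blast
      then show "ag ?e v * x v = 0" by (simp only: mult_zero_right)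
    qed
    then show ?thesis using x(2) by simp
  qed
  ultimately have "\<exists>x\<in>ker ag (W - {?e}). (\<Sum>v\<in>N W ?e. ag ?e v * x v) \<noteq> 0"
    by blast
  from iffD2[OF P.rk_remove_cases(2)[OF W e(2)] this] show False using v(3) by simp
qed

lemma ag_cycle:
  assumes "cyc c" "Suc i < length c"
  shows "ag (c ! Suc i) (c ! i) = cnj (phi (c ! i) (c ! ((i + 1) mod length c)))"
    "ag (c ! Suc i) (c ! (Suc (Suc i) mod length c)) = phi (c ! Suc i) (c ! ((Suc i + 1) mod length c))"
    "phi (c ! i) (c ! ((i + 1) mod length c)) * cnj (phi (c ! i) (c ! ((i + 1) mod length c))) = 1"
    "phi (c ! Suc i) (c ! ((Suc i + 1) mod length c)) * cnj (phi (c ! Suc i) (c ! ((Suc i + 1) mod length c))) = 1"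
proof -
  have e: "E (c ! i) (c ! Suc i)" using assms by (simp add: is_cycle_iff)
  have e2: "E (c ! Suc i) (c ! (Suc (Suc i) mod length c))"
    using assms unfolding is_cycle_def by simp
  show "ag (c ! Suc i) (c ! i) = cnj (phi (c ! i) (c ! ((i + 1) mod length c)))"
    "ag (c ! Suc i) (c ! (Suc (Suc i) mod length c)) = phi (c ! Suc i) (c ! ((Suc i + 1) mod length c))"
    using assms(2) e2 E_sym[OF e] phi_cnj[OF e] by (simp_all add: ag_def)
  show "phi (c ! i) (c ! ((i + 1) mod length c)) * cnj (phi (c ! i) (c ! ((i + 1) mod length c))) = 1"
    "phi (c ! Suc i) (c ! ((Suc i + 1) mod length c)) * cnj (phi (c ! Suc i) (c ! ((Suc i + 1) mod length c))) = 1"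
    using phi_unit[OF e] phi_unit[OF e2] assms(2) by (simp_all flip: complex_norm_square)
qed

text \<open>The rows at odd positions express each even value as minus the product of two gains
  times the next even value. One turn around the even cycle returns to
  \<open>z (c ! 0) \<noteq> 0\<close>, which fixes the gain of the cycle.\<close>

lemma component_type_A:
  assumes W: "W \<subseteq> {0..<n}" and c: "component_cycle W c" and even: "even (length c)"
    and z: "z \<in> ker ag W" "z (c ! 0) \<noteq> 0"
  shows "type_A phi c"
proof -
  have cy: "cyc c" and sub: "set c \<subseteq> W" using c by (auto simp: component_cycle_def)
  have att: "attached_at W c" by (rule component_cycle_attached[OF c])
  let ?g = "\<lambda>i. phi (c ! i) (c ! ((i + 1) mod length c))"
  have "2 * j \<le> length c \<Longrightarrow> z (c ! 0) = (-1) ^ j * (\<Prod>i<2 * j. ?g i) * z (c ! (2 * j mod length c))" for j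
  proof (induction j)
    case (Suc j)
    let ?i = "2 * j"
    have i: "Suc ?i < length c" using Suc.prems by simp
    have mem: "c ! Suc ?i \<in> W" using nth_mem[OF i] sub by blast
    have "cnj (?g ?i) * z (c ! ?i) + ?g (Suc ?i) * z (c ! (Suc (Suc ?i) mod length c)) = 0"
      using P.attached_row[OF W att z(1) subset_refl i mem] unfolding ag_cycle(1,2)[OF cy i] .
    then have "?g ?i * (cnj (?g ?i) * z (c ! ?i) + ?g (Suc ?i) * z (c ! (Suc (Suc ?i) mod length c))) = 0"
      by (simp only: mult_zero_right)
    then have "(?g ?i * cnj (?g ?i)) * z (c ! ?i) + ?g ?i * ?g (Suc ?i) * z (c ! (Suc (Suc ?i) mod length c)) = 0"
      by (simp only: distrib_left mult.assoc)
    then have "z (c ! ?i) = - (?g ?i * ?g (Suc ?i) * z (c ! (Suc (Suc ?i) mod length c)))"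
      unfolding ag_cycle(3)[OF cy i] mult_1 by (simp only: eq_neg_iff_add_eq_0)
    moreover have "z (c ! 0) = (-1) ^ j * (\<Prod>i<2 * j. ?g i) * z (c ! ?i)"
      using Suc.IH i by simp
    moreover have "(\<Prod>i<2 * Suc j. ?g i) = (\<Prod>i<2 * j. ?g i) * (?g ?i * ?g (Suc ?i))"
      by simp
    moreover have "2 * Suc j = Suc (Suc ?i)" by simp
    ultimately show ?case by (simp only: power_Suc) (simp add: mult_ac)
  qed simp
  from this[of "length c div 2"] even z(2)
  have "(-1) ^ (length c div 2) * cycle_gain phi c = 1" by (simp add: cycle_gain_def)
  then have "(-1) ^ (length c div 2) * ((-1) ^ (length c div 2) * cycle_gain phi c) = (-1) ^ (length c div 2)"
    by simp
  moreover have "(-1) ^ (length c div 2) * (-1) ^ (length c div 2) = (1 :: complex)"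
    by (simp flip: power_mult_distrib)
  ultimately have "cycle_gain phi c = (-1) ^ (length c div 2)" by (simp flip: mult.assoc)
  then show ?thesis using even by (simp add: type_A_def)
qed

text \<open>From \<open>c ! 1\<close> to the last vertex there are
  \<open>(length c - 2) div 2\<close> sign changes. If the length were divisible by 4, this number
  would be odd, and the two values in row \<open>c ! 0\<close> would cancel.\<close>

lemma component_length:
  assumes W: "W \<subseteq> {0..<n}" and c: "component_cycle W c" and even: "even (length c)"
    and z: "z \<in> ker a1 (W - {c ! 0})" "(\<Sum>v\<in>N W (c ! 0). a1 (c ! 0) v * z v) \<noteq> 0"
  shows "length c mod 4 = 2"
proof (rule ccontr)
  assume "length c mod 4 \<noteq> 2"
  have cy: "cyc c" using c by (auto simp: component_cycle_def)
  have p: "length c \<ge> 3" using cy by (auto simp: is_cycle_def)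
  obtain j' where "length c = 2 * j'" using even by (rule evenE)
  then obtain j where j: "length c = 2 * j + 2" using p by (cases j') auto
  then have "odd j" using \<open>length c mod 4 \<noteq> 2\<close> by presburger
  have "z (c ! ((1 + 2 * j) mod length c)) = (-1) ^ j * z (c ! (1 mod length c))"
    by (rule alternate[OF W component_cycle_attached[OF c] z(1)]) (use j in simp)
  then have "z (c ! (length c - 1)) = - z (c ! 1)" using \<open>odd j\<close> j p by simp
  moreover have "E (c ! 0) (c ! 1)" "E (c ! 0) (c ! (length c - 1))"
    using component_nbrs_0(1)[OF c] by (auto simp: nbrs_def)
  ultimately have "(\<Sum>v\<in>N W (c ! 0). a1 (c ! 0) v * z v) = 0"
    using component_nbrs_0[OF c] by (simp add: a1_def)
  then show False using z(2) by simp
qed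

lemma component_ranks:
  assumes W: "W \<subseteq> {0..<n}" and c: "component_cycle W c" and A: "type_A phi c"
    and len: "length c mod 4 = 2"
  shows "rg W = rg (W - {c ! 0})" "r1 W = r1 (W - {c ! 0}) + 2"
proof -
  have cy: "cyc c" and sub: "set c \<subseteq> W" using c by (auto simp: component_cycle_def)
  have p: "length c \<ge> 3" and dist: "distinct c" using cy by (auto simp: is_cycle_def)
  have lt: "0 < length c" "1 < length c" "length c - 1 < length c" using p by linarith+
  have even: "even (length c)" using A by (simp add: type_A_def)
  have c0: "c ! 0 \<in> W" using nth_mem[OF lt(1)] sub by blast
  let ?g = "\<lambda>i. phi (c ! i) (c ! ((i + 1) mod length c))"
  \<comment> \<open>Solution of the recursion on even positions, normalised by
    \<open>F 0 = 1\<close>. Type A is exactly the condition that it closes up, with value 1 again at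
    \<open>length c\<close>.\<close>
  define F where "F k = (if even k then (-1) ^ (k div 2) * cnj (\<Prod>i<k. ?g i) else 0)" for k
  have Fp: "F (k mod length c) = F k" if "k \<le> length c" for k
  proof (cases "k = length c")
    case True
    then show ?thesis using A unfolding F_def type_A_def cycle_gain_def
      by (simp flip: power_mult_distrib)
  qed (use that in simp)
  obtain x where x: "x \<in> ker ag W" "\<And>i. i < length c \<Longrightarrow> x (c ! i) = F i"
  proof (rule P.cycle_vector_in_ker[OF W c subset_refl, of F])
    fix i assume i: "Suc i < length c"
    have "cnj (?g i) * F i + ?g (Suc i) * F (Suc (Suc i)) = 0"
    proof (cases "even i")
      case True
      have "?g (Suc i) * F (Suc (Suc i)) =
          - (?g (Suc i) * cnj (?g (Suc i))) * ((-1) ^ (i div 2) * cnj (\<Prod>i<i. ?g i) * cnj (?g i))"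
        using True by (simp add: F_def mult_ac)
      then show ?thesis unfolding ag_cycle(4)[OF cy i] using True by (simp add: F_def mult_ac)
    qed (simp add: F_def)
    moreover have "F (Suc (Suc i) mod length c) = F (Suc (Suc i))" by (rule Fp) (use i in simp)
    ultimately show "ag (c ! Suc i) (c ! i) * F i
      + ag (c ! Suc i) (c ! (Suc (Suc i) mod length c)) * F (Suc (Suc i) mod length c) = 0"
      unfolding ag_cycle(1,2)[OF cy i] by (simp only:)
  next
    have "F 1 = 0" "F (length c - 1) = 0" using even lt by (simp_all add: F_def)
    then show "ag (c ! 0) (c ! 1) * F 1 + ag (c ! 0) (c ! (length c - 1)) * F (length c - 1) = 0" by simp
  qed (use sub nth_mem in blast)+
  have "x (c ! 0) \<noteq> 0" using x(2)[OF lt(1)] by (simp add: F_def)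
  then show "rg W = rg (W - {c ! 0})" using P.rk_remove_cases(1)[OF W c0] x(1) by blast
  \<comment> \<open>Alternating signs on odd positions. For length 2 modulo 4 the first and the last
    of them are both 1, so row \<open>c ! 0\<close> gives 2 instead of 0.\<close>
  define h :: "nat \<Rightarrow> real" where "h k = (if odd k then (-1) ^ (k div 2) else 0)" for k
  have hp: "h (k mod length c) = h k" if "k \<le> length c" for k
    using that even by (cases "k = length c") (simp_all add: h_def)
  have neq: "c ! i \<noteq> c ! 0" if "i < length c" "0 < i" for i
    using nth_eq_iff_index_eq[OF dist that(1) lt(1)] that(2) by simp
  obtain y where y: "y \<in> ker a1 (W - {c ! 0})" "\<And>i. i < length c \<Longrightarrow> y (c ! i) = h i"
  proof (rule O.cycle_vector_in_ker[OF W c Diff_subset, of "{c ! 0}" h])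
    fix i assume "i < length c" "c ! i \<notin> W - {c ! 0}"
    then have "i = 0" using neq[of i] sub nth_mem[of i c] by blast
    then show "h i = 0" by (simp add: h_def)
  next
    fix i assume i: "Suc i < length c"
    have "E (c ! Suc i) (c ! i)" "E (c ! Suc i) (c ! (Suc (Suc i) mod length c))"
      using attached_nbrs(1)[OF component_cycle_attached[OF c] i] by (auto simp: nbrs_def)
    moreover have "h (Suc (Suc i) mod length c) = h (Suc (Suc i))" by (rule hp) (use i in simp)
    moreover have "h i + h (Suc (Suc i)) = 0" by (simp add: h_def)
    ultimately show "a1 (c ! Suc i) (c ! i) * h i
      + a1 (c ! Suc i) (c ! (Suc (Suc i) mod length c)) * h (Suc (Suc i) mod length c) = 0"
      by (simp only: a1_def if_True mult_1)
  qed blast+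
  have "h (length c - 1) = 1"
  proof -
    obtain q where q: "length c = 4 * q + 2" using len by (metis mult_div_mod_eq)
    have "length c - 1 = 2 * (2 * q) + 1" unfolding q by simp
    then show ?thesis by (simp add: h_def)
  qed
  moreover have "E (c ! 0) (c ! 1)" "E (c ! 0) (c ! (length c - 1))"
    using component_nbrs_0(1)[OF c] by (auto simp: nbrs_def)
  ultimately have "(\<Sum>v\<in>N W (c ! 0). a1 (c ! 0) v * y v) = 2"
    using component_nbrs_0[OF c] y(2)[OF lt(2)] y(2)[OF lt(3)] by (simp add: a1_def h_def)
  then have "\<exists>y\<in>ker a1 (W - {c ! 0}). (\<Sum>v\<in>N W (c ! 0). a1 (c ! 0) v * y v) \<noteq> 0"
    by (intro bexI[OF _ y(1)]) simp
  then show "r1 W = r1 (W - {c ! 0}) + 2" using O.rk_remove_cases(2)[OF W c0] by blast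
qed

lemma component_rank_difference:
  assumes W: "W \<subseteq> {0..<n}" and c: "component_cycle W c" and A: "type_A phi c"
    and len: "length c mod 4 = 2"
  shows "rg W - r1 W = rg (W - set c) - r1 (W - set c) - 2"
proof -
  obtain T where T: "(delta_step E)\<^sup>*\<^sup>* (W - {c ! 0}) T"
    "T = W - set c \<or> (\<exists>y\<in>T. N T y = {} \<and> T - {y} = W - set c)"
    using peel_to_rest[OF W component_cycle_attached[OF c]] by blast
  have "W - {c ! 0} \<subseteq> {0..<n}" using W by blast
  from delta_steps_rank[OF T(1) this] this
  have t: "T \<subseteq> {0..<n}" "rg T - r1 T = rg (W - {c ! 0}) - r1 (W - {c ! 0})" by auto
  have "rg (W - set c) - r1 (W - set c) = rg T - r1 T"
    using T(2)
  proof (elim disjE bexE conjE)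
    fix y assume y: "y \<in> T" "N T y = {}" "T - {y} = W - set c"
    show ?thesis using P.rk_isolated[OF t(1) y(1,2)] O.rk_isolated[OF t(1) y(1,2)] unfolding y(3) by simp
  qed simp
  then show ?thesis using t(2) component_ranks[OF assms] by simp
qed

end

section \<open>Characterisation of tightness\<close>

context graph
begin

abbreviation edg :: "nat set \<Rightarrow> nat set set" where
  "edg W \<equiv> {{u, v} | u v. u \<in> W \<and> v \<in> W \<and> E u v}"

text \<open>Disjointness is symmetric, so \<open>sorted_wrt\<close> expresses it for all pairs and
  decomposes along \<open>Cons\<close> in inductions.\<close>

lemma union_cycles_isolated_iff:
  "union_cycles_isolated n E W k \<longleftrightarrow> (\<exists>cs. length cs = k \<and> (\<forall>c\<in>set cs. cyc c \<and> set c \<subseteq> W)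
     \<and> sorted_wrt (\<lambda>c d. set c \<inter> set d = {}) cs \<and> edg W = (\<Union>c\<in>set cs. cycle_edges c))"
proof -
  have "sorted_wrt (\<lambda>c d. set c \<inter> set d = {}) cs \<longleftrightarrow>
      (\<forall>i<length cs. \<forall>j<length cs. i \<noteq> j \<longrightarrow> set (cs ! i) \<inter> set (cs ! j) = {})" (is "?L \<longleftrightarrow> ?R")
    for cs :: "nat list list"
  proof
    assume L: ?L
    have "set (cs ! i) \<inter> set (cs ! j) = {}" if "i < length cs" "j < length cs" "i \<noteq> j" for i j
    proof (cases "i < j")
      case True
      then show ?thesis using L that(2) unfolding sorted_wrt_iff_nth_less by blast
    next
      case False
      then have "j < i" using that(3) by linarith
      then have "set (cs ! j) \<inter> set (cs ! i) = {}" using L that(1) unfolding sorted_wrt_iff_nth_less by blast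
      then show ?thesis by blast
    qed
    then show ?R by blast
  next
    assume R: ?R
    show ?L unfolding sorted_wrt_iff_nth_less
    proof (intro allI impI)
      fix i j assume "i < j" "j < length cs"
      then show "set (cs ! i) \<inter> set (cs ! j) = {}" using R[rule_format, of i j] by simp
    qed
  qed
  then show ?thesis unfolding union_cycles_isolated_def by (metis (no_types, lifting))
qed

lemma union_cycles_isolatedE:
  assumes "union_cycles_isolated n E W k"
  obtains cs where "length cs = k" "\<forall>c\<in>set cs. cyc c \<and> set c \<subseteq> W"
    "sorted_wrt (\<lambda>c d. set c \<inter> set d = {}) cs" "edg W = (\<Union>c\<in>set cs. cycle_edges c)"
proof -
  from iffD1[OF union_cycles_isolated_iff assms] obtain cs where
    *: "length cs = k \<and> (\<forall>c\<in>set cs. cyc c \<and> set c \<subseteq> W)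
     \<and> sorted_wrt (\<lambda>c d. set c \<inter> set d = {}) cs \<and> edg W = (\<Union>c\<in>set cs. cycle_edges c)" by (rule exE)
  show thesis
    by (rule that[OF conjunct1[OF *] conjunct1[OF conjunct2[OF *]]
      conjunct1[OF conjunct2[OF conjunct2[OF *]]] conjunct2[OF conjunct2[OF conjunct2[OF *]]]])
qed

lemma edg_N: "{u, v} \<in> edg W \<longleftrightarrow> u \<in> W \<and> v \<in> N W u"
proof
  assume "{u, v} \<in> edg W"
  then obtain x y where "{u, v} = {x, y}" "x \<in> W" "y \<in> W" "E x y" by blast
  then show "u \<in> W \<and> v \<in> N W u" using E_sym[of x y] by (auto simp: doubleton_eq_iff N_iff)
qed (auto simp: N_iff)

lemma cycle_edges_edg: "cyc c \<Longrightarrow> set c \<subseteq> W \<Longrightarrow> cycle_edges c \<subseteq> edg W"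
proof
  fix e assume c: "cyc c" "set c \<subseteq> W" and "e \<in> cycle_edges c"
  then obtain i where i: "i < length c" "e = {c ! i, c ! ((i + 1) mod length c)}"
    unfolding cycle_edges_def by blast
  have "(i + 1) mod length c < length c" using i(1) by (intro mod_less_divisor) linarith
  then have "c ! ((i + 1) mod length c) \<in> W" "c ! i \<in> W" using i(1) c(2) nth_mem by blast+
  moreover have "E (c ! i) (c ! ((i + 1) mod length c))" using c(1) i(1) unfolding is_cycle_def by blast
  ultimately show "e \<in> edg W" unfolding i(2) edg_N N_iff by blast
qed

lemma edg_split:
  assumes c: "component_cycle W c"
  shows "edg W = cycle_edges c \<union> edg (W - set c)"
proof
  show "edg W \<subseteq> cycle_edges c \<union> edg (W - set c)"
  proof
    fix e assume "e \<in> edg W"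
    then obtain u v where e: "e = {u, v}" "u \<in> W" "v \<in> W" "E u v" by blast
    consider "u \<in> set c" | "v \<in> set c" | "u \<notin> set c" "v \<notin> set c" by blast
    then show "e \<in> cycle_edges c \<union> edg (W - set c)"
    proof cases
      case 1
      moreover have "v \<in> N W u" using e by (simp add: N_iff)
      ultimately show ?thesis using c e(1) unfolding component_cycle_def by blast
    next
      case 2
      moreover have "u \<in> N W v" using e E_sym[OF e(4)] by (simp add: N_iff)
      ultimately have "{v, u} \<in> cycle_edges c" using c unfolding component_cycle_def by blast
      then show ?thesis using e(1) by (simp add: insert_commute)
    next
      case 3
      then have "v \<in> N (W - set c) u" using e by (simp add: N_iff)
      then show ?thesis using 3 e edg_N[of u v "W - set c"] by simp
    qed
  qed
  have "edg (W - set c) \<subseteq> edg W" by blast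
  moreover have "cycle_edges c \<subseteq> edg W" using c cycle_edges_edg by (simp add: component_cycle_def)
  ultimately show "cycle_edges c \<union> edg (W - set c) \<subseteq> edg W" by (rule Un_least[rotated])
qed

lemma component_N_outside:
  assumes c: "component_cycle W c" and w: "w \<in> W - set c"
  shows "N (W - set c) w = N W w"
proof -
  have "v \<notin> set c" if "v \<in> N W w" for v
  proof
    assume v: "v \<in> set c"
    have "w \<in> N W v" using that w E_sym[of w v] by (simp add: N_iff)
    then have "{v, w} \<in> cycle_edges c" using c v unfolding component_cycle_def by blast
    then show False using in_cycle_edges_set w by blast
  qed
  then show ?thesis by (auto simp: N_iff)
qed

lemma cyclomatic_edgeless:
  assumes "W \<subseteq> {0..<n}" "\<forall>v\<in>W. N W v = {}"
  shows "\<theta> W = 0"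
  using finite_W[OF assms(1)] assms
proof (induction W rule: finite_remove_induct)
  case (remove W)
  then obtain x where x: "x \<in> W" by blast
  have "\<forall>v\<in>W - {x}. N (W - {x}) v = {}" using remove.prems by (auto simp: nbrs_def)
  then have "\<theta> (W - {x}) = 0" using remove.IH[OF x] remove.prems by blast
  then show ?case using cyclomatic_remove_isolated[OF remove.prems(1) x] remove.prems x by simp
qed (simp add: cyclomatic_empty)

lemma delta_steps_no_pendant:
  assumes "(delta_step E)\<^sup>*\<^sup>* W W'" "no_pendant E W"
  shows "W' = W"
  using assms(1)
proof (cases rule: converse_rtranclpE)
  case (step V)
  then show ?thesis using assms(2) by (auto simp: delta_step_def no_pendant_def)
qed simp

end

lemma (in weighted_graph) rk_edgeless:
  assumes "W \<subseteq> {0..<n}" "\<forall>v\<in>W. N W v = {}"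
  shows "rk a W = 0"
  using finite_W[OF assms(1)] assms
proof (induction W rule: finite_remove_induct)
  case (remove W)
  then obtain x where x: "x \<in> W" by blast
  have "\<forall>v\<in>W - {x}. N (W - {x}) v = {}" using remove.prems by (auto simp: nbrs_def)
  then have "rk a (W - {x}) = 0" using remove.IH[OF x] remove.prems by blast
  then show ?case using rk_isolated[OF remove.prems(1) x] remove.prems x by simp
qed (simp add: rk_empty)

context gain_graph
begin

text \<open>An edge at a vertex of \<open>c\<close> lies on some listed cycle, and disjointness
  makes that cycle \<open>c\<close> itself. So \<open>c\<close> is a component and can be stripped
  off at a cost of 2.\<close>

lemma union_of_cycles_rank:
  assumes "W \<subseteq> {0..<n}" "\<forall>c\<in>set cs. cyc c \<and> set c \<subseteq> W \<and> type_A phi c \<and> length c mod 4 = 2"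
    "sorted_wrt (\<lambda>c d. set c \<inter> set d = {}) cs" "edg W = (\<Union>c\<in>set cs. cycle_edges c)"
  shows "rg W - r1 W = - 2 * int (length cs)"
  using assms
proof (induction cs arbitrary: W)
  case Nil
  have "\<forall>v\<in>W. N W v = {}"
  proof (intro ballI equals0I)
    fix u v assume "u \<in> W" "v \<in> N W u"
    then have "{u, v} \<in> edg W" unfolding edg_N by blast
    then show False using Nil.prems(4) by simp
  qed
  then show ?case using P.rk_edgeless[OF Nil.prems(1)] O.rk_edgeless[OF Nil.prems(1)] by simp
next
  case (Cons c cs)
  have c: "cyc c" "set c \<subseteq> W" "type_A phi c" "length c mod 4 = 2" using Cons.prems(2) by auto
  have disj: "set c \<inter> set d = {}" if "d \<in> set cs" for d using Cons.prems(3) that by simp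
  have comp: "component_cycle W c"
    unfolding component_cycle_def
  proof (intro conjI ballI c(1,2))
    fix y w assume y: "y \<in> set c" and w: "w \<in> N W y"
    then have "{y, w} \<in> edg W" using c(2) unfolding edg_N by blast
    then obtain d where d: "d \<in> set (c # cs)" "{y, w} \<in> cycle_edges d" unfolding Cons.prems(4) by blast
    have "y \<in> set d" using d(2) in_cycle_edges_set[of w y d] by (simp add: insert_commute)
    then have "d = c" using d(1) disj[of d] y by auto
    then show "{y, w} \<in> cycle_edges c" using d(2) by simp
  qed
  let ?K = "W - set c"
  have "rg ?K - r1 ?K = - 2 * int (length cs)"
  proof (rule Cons.IH)
    show "?K \<subseteq> {0..<n}" using Cons.prems(1) by blast
    show cyK: "\<forall>d\<in>set cs. cyc d \<and> set d \<subseteq> ?K \<and> type_A phi d \<and> length d mod 4 = 2"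
      using Cons.prems(2) disj by auto
    show "sorted_wrt (\<lambda>c d. set c \<inter> set d = {}) cs" using Cons.prems(3) by simp
    show "edg ?K = (\<Union>d\<in>set cs. cycle_edges d)"
    proof
      show "(\<Union>d\<in>set cs. cycle_edges d) \<subseteq> edg ?K"
      proof (rule UN_least)
        fix d assume "d \<in> set cs"
        then show "cycle_edges d \<subseteq> edg ?K" using cyK cycle_edges_edg[of d ?K] by blast
      qed
      show "edg ?K \<subseteq> (\<Union>d\<in>set cs. cycle_edges d)"
      proof
        fix e assume eK: "e \<in> edg ?K"
        then obtain u v where e: "e = {u, v}" "v \<notin> set c" by blast
        have "e \<in> edg W" using eK unfolding edg_split[OF comp] by (rule UnI2)
        then obtain d where d: "d \<in> set (c # cs)" "e \<in> cycle_edges d" unfolding Cons.prems(4) by blast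
        have "v \<in> set d" using d(2) in_cycle_edges_set unfolding e(1) by blast
        then show "e \<in> (\<Union>d\<in>set cs. cycle_edges d)" using d e(2) by auto
      qed
    qed
  qed
  then show ?case using component_rank_difference[OF Cons.prems(1) comp c(3,4)] by simp
qed

text \<open>Conditions (2) and (3) for the induced subgraph; condition (1) is supplied by
  \<open>tight_disjoint_cycles\<close>. The list length in the decomposition requires
  \<open>nat\<close>.\<close>

definition good :: "nat set \<Rightarrow> bool" where
  "good W \<longleftrightarrow> (\<forall>c. cyc c \<and> set c \<subseteq> W \<longrightarrow> type_A phi c \<and> length c mod 4 = 2)
     \<and> (\<exists>W0. (delta_step E)\<^sup>*\<^sup>* W W0 \<and> no_pendant E W0 \<and> union_cycles_isolated n E W0 (nat (\<theta> W)))"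

lemma good_no_pendant:
  assumes "good W" "no_pendant E W"
  shows "union_cycles_isolated n E W (nat (\<theta> W))"
proof -
  have "\<exists>W0. (delta_step E)\<^sup>*\<^sup>* W W0 \<and> no_pendant E W0 \<and> union_cycles_isolated n E W0 (nat (\<theta> W))"
    using assms(1) unfolding good_def by (rule conjunct2)
  then obtain W0 where W0: "(delta_step E)\<^sup>*\<^sup>* W W0" "union_cycles_isolated n E W0 (nat (\<theta> W))"
    by (elim exE conjE)
  have "W0 = W" by (rule delta_steps_no_pendant[OF W0(1) assms(2)])
  then show ?thesis using W0(2) by (simp only:)
qed

lemma good_no_pendant_cycle:
  assumes "good W" "no_pendant E W" "v \<in> W" "N W v \<noteq> {}"
  obtains c where "cyc c" "set c \<subseteq> W" "v \<in> set c"
proof -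
  obtain cs where cs: "\<forall>c\<in>set cs. cyc c \<and> set c \<subseteq> W" "edg W = (\<Union>c\<in>set cs. cycle_edges c)"
    using good_no_pendant[OF assms(1,2)] by (rule union_cycles_isolatedE)
  obtain u where "u \<in> N W v" using assms(4) by blast
  then have "{u, v} \<in> edg W" using assms(3) edg_N[of v u W] by (simp add: insert_commute)
  then obtain c where "c \<in> set cs" "{u, v} \<in> cycle_edges c" unfolding cs(2) by blast
  then show thesis using that cs(1) in_cycle_edges_set by blast
qed

text \<open>Peeling off \<open>e\<close> and its neighbour moves the dangling end inwards, so it would have to stop at a
  cycle; but the neighbour of a pendant vertex never lies on one.\<close>

lemma no_dangling_end:
  assumes IH: "\<And>V. V \<subseteq> {0..<n} \<Longrightarrow> card V < m \<Longrightarrow> tight V \<Longrightarrow> good V"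
    and "H \<subseteq> {0..<n}" "card H < m" "e \<in> H" "tight H" "tight (H - {e})" "N H e \<noteq> {}"
    "\<And>c. cyc c \<Longrightarrow> set c \<subseteq> H \<Longrightarrow> e \<notin> set c" "\<And>w. w \<in> H - {e} \<Longrightarrow> card (N H w) \<noteq> 1"
  shows False
  using assms(2-)
proof (induction "card H" arbitrary: H e rule: less_induct)
  case less
  note H = less.prems
  show False
  proof (cases "card (N H e) = 1")
    case False
    \<comment> \<open>As \<open>e\<close> is not isolated either, \<open>good\<close> would put it
      on a cycle of \<open>H\<close>.\<close>
    then have "no_pendant E H" unfolding no_pendant_def deg_in_N using H(8) by blast
    then show False using good_no_pendant_cycle[OF IH[OF H(1,2,4)] _ H(3,6)] H(7) by metis
  next
    case True
    then obtain f where f: "N H e = {f}" by (rule card_1_singletonE)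
    let ?K = "H - {e}"
    have "f \<in> N H e" using f by simp
    then have fH: "f \<in> ?K" "E e f" "E f e" using E_irrefl E_sym[of e f] by (auto simp: N_iff)
    have lt: "card ?K < card H" using H(3) finite_W[OF H(1)] by (intro psubset_card_mono) auto
    note p = tight_pendant[OF H(1,3) f H(4)]
    have Kf: "?K - {f} = H - {e, f}" by blast
    have e: "e \<in> N H f" using fH H(3) by (simp add: N_iff)
    \<comment> \<open>The pair \<open>?K\<close>, \<open>f\<close> inherits the situation:
      \<open>?K\<close> was tight by assumption, \<open>?K - {f}\<close> is what the pendant vertex
      \<open>e\<close> leaves after a step, and \<open>f\<close> lies on no cycle.\<close>
    show False
    proof (rule less.hyps[OF lt, of f])
      show "?K \<subseteq> {0..<n}" "card ?K < m" "f \<in> ?K" "tight ?K" using H lt fH by auto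
      show "tight (?K - {f})" using p(1) unfolding Kf .
      show "N ?K f \<noteq> {}"
      proof
        assume "N ?K f = {}"
        then have "N H f = {e}" using e by (auto simp: nbrs_def)
        then show False using H(8)[of f] fH by simp
      qed
      show "f \<notin> set c" if "cyc c" "set c \<subseteq> ?K" for c
        using p(3)[OF that(1)] that(2) by blast
      show "card (N ?K w) \<noteq> 1" if w: "w \<in> ?K - {f}" for w
      proof -
        have "w \<notin> N H e" using w f by simp
        then have "\<not> E e w" using w by (simp add: N_iff)
        then have "\<not> E w e" using E_sym by blast
        then have "N ?K w = N H w" by (auto simp: nbrs_def)
        then show ?thesis using H(8)[of w] w by simp
      qed
    qed
  qed
qed

text \<open>Starting at \<open>c ! 1\<close> and using even length, peeling leaves
  \<open>c ! 0\<close> together with the rest; starting at \<open>c ! 0\<close> it leaves the rest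
  alone. Both are tight, so an edge from \<open>c ! 0\<close> off the cycle would be a dangling
  end.\<close>

lemma tight_component_cycle:
  assumes IH: "\<And>V. V \<subseteq> {0..<n} \<Longrightarrow> card V < card W \<Longrightarrow> tight V \<Longrightarrow> good V"
    and W: "W \<subseteq> {0..<n}" and "tight W" and np: "no_pendant E W" and c: "attached_at W c"
  shows "component_cycle W c"
proof (rule ccontr)
  assume notc: "\<not> component_cycle W c"
  let ?e = "c ! 0" and ?K = "W - set c"
  let ?H = "insert ?e ?K"
  have cy: "cyc c" "set c \<subseteq> W" using c by (auto simp: attached_at_def)
  have p: "length c \<ge> 3" and dist: "distinct c" using cy by (auto simp: is_cycle_def)
  have lt: "0 < length c" "1 < length c" using p by linarith+
  have e: "?e \<in> set c" "?e \<in> W" and c1: "c ! 1 \<in> set c" using nth_mem lt cy by auto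
  have c1e: "c ! 1 \<noteq> ?e" using nth_eq_iff_index_eq[OF dist lt(2,1)] by simp
  have H: "?H \<subseteq> W" "?H \<subseteq> {0..<n}" "?H - {?e} = ?K" "c ! 1 \<notin> ?H" using W e c1 c1e by auto
  obtain w where w: "w \<in> N W ?e" "{?e, w} \<notin> cycle_edges c"
  proof -
    obtain y w where "y \<in> set c" "w \<in> N W y" "{y, w} \<notin> cycle_edges c"
      using notc cy unfolding component_cycle_def by blast
    moreover have "y = ?e" using calculation c unfolding attached_at_def by blast
    ultimately show thesis using that by blast
  qed
  have wK: "w \<in> ?K"
  proof -
    have "w \<notin> set c"
    proof
      assume ws: "w \<in> set c"
      have "w \<noteq> ?e" using w(1) E_irrefl by (auto simp: N_iff)
      moreover have "?e \<in> N W w" using w(1) e E_sym[of ?e w] by (simp add: N_iff)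
      ultimately have "{w, ?e} \<in> cycle_edges c" using c ws unfolding attached_at_def by blast
      then show False using w(2) by (simp add: insert_commute)
    qed
    then show ?thesis using w(1) by (simp add: N_iff)
  qed
  obtain j' where "length c = 2 * j'" using tight_even_cycle[OF W \<open>tight W\<close> c] by (rule evenE)
  then obtain j where j: "length c = 2 * j + 2" using p by (cases j') auto
  have "(delta_step E)\<^sup>*\<^sup>* (W - {c ! 1}) ?H"
  proof -
    have "(!) c ` {1..1 + 2 * j} = set c - {?e}"
    proof -
      have "set c = (!) c ` {0..<length c}" unfolding set_conv_nth by auto
      moreover have "{0..<length c} = insert 0 {1..1 + 2 * j}" using j by auto
      moreover have "?e \<notin> (!) c ` {1..1 + 2 * j}"
      proof
        assume "?e \<in> (!) c ` {1..1 + 2 * j}"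
        then obtain i where "1 \<le> i" "i < length c" "?e = c ! i" using j by auto
        then show False using nth_eq_iff_index_eq[OF dist lt(1), of i] by simp
      qed
      ultimately show ?thesis by auto
    qed
    then have "W - (!) c ` {1..1 + 2 * j} = ?H" using e by auto
    then show ?thesis using peel[OF c, of 1 j] j by simp
  qed
  moreover have "tight (W - {c ! 1})" by (rule tight_cycle_vertex(1)[OF W \<open>tight W\<close> cy c1])
  moreover have "W - {c ! 1} \<subseteq> {0..<n}" using W by blast
  ultimately have "tight ?H" using delta_steps_tight by blast
  show False
  proof (rule no_dangling_end[OF IH, of "card W" ?H ?e])
    show "card ?H < card W"
      using H(1,4) c1 cy(2) finite_W[OF W] by (intro psubset_card_mono) auto
    show "tight (?H - {?e})" unfolding H(3) by (rule tight_rest(1)[OF W \<open>tight W\<close> c])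
    show "N ?H ?e \<noteq> {}" using w(1) wK by (auto simp: nbrs_def)
    \<comment> \<open>By disjointness such a cycle would have the edges of \<open>c\<close>, but
      \<open>c ! 1\<close> is missing from \<open>?H\<close>.\<close>
    show "?e \<notin> set d" if d: "cyc d" "set d \<subseteq> ?H" for d
    proof
      assume "?e \<in> set d"
      then have "cycle_edges d = cycle_edges c"
        using tight_disjoint_cycles[OF W \<open>tight W\<close>] cy d e(1) H(1) unfolding disjoint_cycles_def by blast
      moreover have "{?e, c ! 1} \<in> cycle_edges c"
        unfolding cycle_edges_eq[OF p] using lt(2) by auto
      ultimately have "c ! 1 \<in> set d" using in_cycle_edges_set by blast
      then show False using d(2) H(4) by blast
    qed
    show "card (N ?H w) \<noteq> 1" if w: "w \<in> ?H - {?e}" for w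
    proof -
      have "v \<in> ?H" if "v \<in> N W w" for v
      proof (rule ccontr)
        assume "v \<notin> ?H"
        then have "v \<in> set c" "v \<noteq> ?e" using that by (auto simp: N_iff)
        moreover have "w \<in> N W v" using that w H(1) E_sym[of w v] by (auto simp: N_iff)
        ultimately have "w \<in> set c" by (rule attached_no_exit[OF c])
        then show False using w by blast
      qed
      then have "N ?H w = N W w" using H(1) by (auto simp: N_iff)
      then show ?thesis using np w unfolding no_pendant_def deg_in_N by auto
    qed
  qed (use \<open>tight ?H\<close> H in auto)
qed

lemma tight_good: "W \<subseteq> {0..<n} \<Longrightarrow> tight W \<Longrightarrow> good W"
proof (induction "card W" arbitrary: W rule: less_induct)
  case less
  note W = less.prems(1) and tight = less.prems(2)
  have IH: "good V" if "V \<subseteq> {0..<n}" "card V < card W" "tight V" for V using less.hyps that by blast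
  show ?case
  proof (cases "no_pendant E W")
    case False
    then obtain u where u: "u \<in> W" "card (N W u) = 1" unfolding no_pendant_def deg_in_N by blast
    then obtain v where v: "N W u = {v}" using card_1_singletonE by blast
    let ?V = "W - {u, v}"
    note p = tight_pendant[OF W u(1) v tight]
    have "?V \<subseteq> {0..<n}" using W by blast
    moreover have "card ?V < card W" using u(1) finite_W[OF W] by (intro psubset_card_mono) auto
    ultimately have g: "good ?V" using IH p(1) by blast
    then obtain W0 where W0: "(delta_step E)\<^sup>*\<^sup>* ?V W0" "no_pendant E W0"
      "union_cycles_isolated n E W0 (nat (\<theta> W))"
      using p(2) unfolding good_def by auto
    have "(delta_step E)\<^sup>*\<^sup>* W W0"
      by (rule converse_rtranclp_into_rtranclp[of _ _ ?V]) (rule delta_stepI[OF u(1) v], rule W0(1))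
    then show ?thesis using W0(2,3) g p(3) unfolding good_def by blast
  next
    case np: True
    show ?thesis
    proof (cases "\<exists>v\<in>W. N W v \<noteq> {}")
      case False
      then have iso: "\<forall>v\<in>W. N W v = {}" by blast
      have "\<not> cyc c" if "set c \<subseteq> W" for c
      proof
        assume c: "cyc c"
        then have "{c ! 0, c ! 1} \<in> cycle_edges c"
          using cycle_edges_eq[of c] by (auto simp: is_cycle_def)
        then have "{c ! 0, c ! 1} \<in> edg W" using cycle_edges_edg[OF c that] by blast
        then show False using iso unfolding edg_N by blast
      qed
      moreover have "edg W = {}" using iso edg_N by blast
      then have "union_cycles_isolated n E W (nat (\<theta> W))"
        unfolding union_cycles_isolated_iff cyclomatic_edgeless[OF W iso] by (intro exI[of _ "[]"]) simp
      ultimately show ?thesis unfolding good_def using np by blast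
    next
      case True
      then obtain v where v: "v \<in> W" "N W v \<noteq> {}" by blast
      have disj: "disjoint_cycles W" by (rule tight_disjoint_cycles[OF W tight])
      obtain b e where b: "cyc b" "set b \<subseteq> W" "e \<in> set b"
        "\<And>y w. y \<in> set b \<Longrightarrow> y \<noteq> e \<Longrightarrow> w \<in> N W y \<Longrightarrow> {y, w} \<in> cycle_edges b"
        using end_cycle[OF W disj np v] by blast
      \<comment> \<open>Rotation puts the possible attachment vertex at index 0.\<close>
      obtain c where c: "cyc c" "c ! 0 = e" "set c = set b" "cycle_edges c = cycle_edges b"
        using cycle_at[OF b(1,3)] by metis
      have "attached_at W c" unfolding attached_at_def c using c(1) b(2,4) by blast
      then have comp: "component_cycle W c"
        by (intro tight_component_cycle[OF _ W tight np]) (rule IH)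
      let ?K = "W - set c"
      note rest = tight_rest[OF W tight component_cycle_attached[OF comp]]
      have "set c \<subseteq> W" "c ! 0 \<in> set c" using b(2,3) c by auto
      then have "card ?K < card W" using finite_W[OF W] by (intro psubset_card_mono) auto
      then have gK: "good ?K" using IH[of ?K] W rest(1) by blast
      have "type_A phi d \<and> length d mod 4 = 2" if d: "cyc d" "set d \<subseteq> W" for d
      proof (cases "cycle_edges d = cycle_edges c")
        \<comment> \<open>A list with the edges of \<open>c\<close> may be rotated or reversed, and
          its gain is claimed as well; \<open>d\<close> is itself a component cycle, so the kernel
          argument is applied to \<open>d\<close> directly.\<close>
        case True
        have dc: "component_cycle W d" unfolding component_cycle_def
        proof (intro conjI ballI d)
          fix y w assume y: "y \<in> set d" "w \<in> N W y"
          obtain a where "{y, a} \<in> cycle_edges d" using cycle_nbrs[OF d(1) y(1)] 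
            by (metis insertI1 mem_Collect_eq)
          then have "{a, y} \<in> cycle_edges c" using True by (simp add: insert_commute)
          then have "y \<in> set c" by (rule in_cycle_edges_set)
          then show "{y, w} \<in> cycle_edges d" using comp y(2) True unfolding component_cycle_def by blast
        qed
        have d0: "d ! 0 \<in> set d" using d(1) by (intro nth_mem) (auto simp: is_cycle_def)
        then have d0W: "d ! 0 \<in> W" using d(2) by blast
        note even = tight_even_cycle[OF W tight component_cycle_attached[OF dc]]
        note t = tight_cycle_vertex[OF W tight d d0]
        from iffD1[OF P.rk_remove_cases(1)[OF W d0W] t(3)]
        have "type_A phi d" using component_type_A[OF W dc even] by blast
        moreover from iffD1[OF O.rk_remove_cases(2)[OF W d0W] t(4)]
        have "length d mod 4 = 2" using component_length[OF W dc even] by blast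
        ultimately show ?thesis by blast
      next
        case False
        then have "set d \<inter> set c = {}"
          using disj d c b(2) unfolding disjoint_cycles_def by blast
        then show ?thesis using gK d unfolding good_def by blast
      qed
      moreover have "union_cycles_isolated n E W (nat (\<theta> W))"
      proof -
        have "no_pendant E ?K"
          using np component_N_outside[OF comp] unfolding no_pendant_def deg_in_N by auto
        from good_no_pendant[OF gK this] obtain cs where cs: "length cs = nat (\<theta> ?K)"
          "\<forall>d\<in>set cs. cyc d \<and> set d \<subseteq> ?K" "sorted_wrt (\<lambda>c d. set c \<inter> set d = {}) cs"
          "edg ?K = (\<Union>d\<in>set cs. cycle_edges d)"
          by (rule union_cycles_isolatedE)
        \<comment> \<open>Nonnegativity lets \<open>nat\<close> turn
          \<open>\<theta> W = \<theta> ?K + 1\<close> into one more cycle in the list.\<close>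
        have "\<theta> ?K \<ge> 0" by (rule cyclomatic_nonneg) (use W in blast)
        then have "length (c # cs) = nat (\<theta> W)" using cs(1) rest(2) by (simp add: nat_diff_distrib)
        moreover have "edg W = (\<Union>d\<in>set (c # cs). cycle_edges d)"
          unfolding edg_split[OF comp] cs(4) by simp
        moreover have "\<forall>d\<in>set (c # cs). cyc d \<and> set d \<subseteq> W" using cs(2) c(1,3) b(2) by auto
        moreover have "sorted_wrt (\<lambda>c d. set c \<inter> set d = {}) (c # cs)" using cs(2,3) by auto
        ultimately show ?thesis
          by (intro iffD2[OF union_cycles_isolated_iff] exI[of _ "c # cs"] conjI)
      qed
      ultimately show ?thesis unfolding good_def using np by blast
    qed
  qed
qed

end

theorem theorem4p8:
  fixes n :: nat and E :: "nat \<Rightarrow> nat \<Rightarrow> bool" and phi :: "nat \<Rightarrow> nat \<Rightarrow> complex"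
  assumes "simple_graph n E" and "unit_gain E phi"
  shows "int (gain_rank n E phi) = int (graph_rank n E) - 2 * theta n E \<longleftrightarrow>
    ((\<forall>c1 c2. is_cycle n E c1 \<and> is_cycle n E c2 \<and> cycle_edges c1 \<noteq> cycle_edges c2
        \<longrightarrow> set c1 \<inter> set c2 = {})
     \<and> (\<forall>c. is_cycle n E c \<longrightarrow> type_A phi c \<and> length c mod 4 = 2)
     \<and> (\<exists>W. (delta_step E)\<^sup>*\<^sup>* {0..<n} W \<and> no_pendant E W
          \<and> union_cycles_isolated n E W (nat (theta n E))))"
proof -
  interpret gain_graph n E phi by unfold_locales (use assms in auto)
  have cyc_sub: "set c \<subseteq> {0..<n}" if "is_cycle n E c" for c using that by (simp add: is_cycle_def)
  have tight_iff: "int (gain_rank n E phi) = int (graph_rank n E) - 2 * theta n E \<longleftrightarrow> tight {0..<n}"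
    unfolding tight_def gain_rank_eq graph_rank_eq theta_eq_cyclomatic ..
  show ?thesis (is "?L \<longleftrightarrow> ?disj \<and> ?types \<and> ?crucial")
  proof
    assume ?L
    then have t: "tight {0..<n}" using tight_iff by simp
    have ?disj
      using tight_disjoint_cycles[OF subset_refl t] cyc_sub unfolding disjoint_cycles_def by blast
    moreover have g: "good {0..<n}" by (rule tight_good[OF subset_refl t])
    then have ?types using cyc_sub unfolding good_def by blast
    moreover have ?crucial using g unfolding good_def theta_eq_cyclomatic by (elim conjE)
    ultimately show "?disj \<and> ?types \<and> ?crucial" by blast
  next
    assume R: "?disj \<and> ?types \<and> ?crucial"
    then obtain W where W: "(delta_step E)\<^sup>*\<^sup>* {0..<n} W"
      "union_cycles_isolated n E W (nat (theta n E))" by blast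
    \<comment> \<open>The difference of the ranks is the same on \<open>W\<close> as on the whole
      graph, and on \<open>W\<close> each of the \<open>\<theta>\<close> cycles contributes
      -2.\<close>
    have sub: "W \<subseteq> {0..<n}" and diff: "rg W - r1 W = rg {0..<n} - r1 {0..<n}"
      using delta_steps_rank[OF W(1) subset_refl] by auto
    obtain cs where cs: "length cs = nat (theta n E)" "\<forall>c\<in>set cs. is_cycle n E c \<and> set c \<subseteq> W"
      "sorted_wrt (\<lambda>c d. set c \<inter> set d = {}) cs" "edg W = (\<Union>c\<in>set cs. cycle_edges c)"
      using W(2) by (rule union_cycles_isolatedE)
    have "\<forall>c\<in>set cs. is_cycle n E c \<and> set c \<subseteq> W \<and> type_A phi c \<and> length c mod 4 = 2"
      using cs(2) R by blast
    from union_of_cycles_rank[OF sub this cs(3,4)] have "rg {0..<n} - r1 {0..<n} = - 2 * theta n E"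
      using diff cs(1) cyclomatic_nonneg[OF subset_refl] unfolding theta_eq_cyclomatic by simp
    then show ?L unfolding gain_rank_eq graph_rank_eq by linarith
  qed
qed

end
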